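(* There are positive constants $c$ and $c'$ such that for all integers $n\ge 2$, \[ 2^{c\log^2 n}\;\le\; r\big(K_4^{(3)},\ S_n^{(3)}\big)\;\le\; 2^{c' n^{2/3}\log n}. \] Moreover, for each integer $s\ge 5$ there are positive constants $c_s$ and $c_s'$ such that for all integers $n\ge 2$, \[ 2^{c_s n}\;\le\; r\big(K_s^{(3)},\ S_n^{(3)}\big)\;\le\; 2^{c_s' n}. \]
   Context: A $3$-graph is a $3$-uniform hypergraph; $K_m^{(3)}$ denotes the complete $3$-graph on $m$ vertices. $S_n^{(3)}$ is the star $3$-graph on $n+1$ vertices: a distinguished vertex $v$ and $n$ further vertices, whose edges are all $\binom{n}{2}$ triples containing $v$. For $3$-graphs $H_1,H_2$, the Ramsey number $r(H_1,H_2)$ is the smallest $N$ such that every red/blue coloring of the edges of $K_N^{(3)}$ contains a red copy of $H_1$ or a blue copy of $H_2$. Logarithms are base $2$. *)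

theory Defs
  imports Complex_Main "HOL-Library.Ramsey"
begin

record 'a hypergraph =
  verts :: "'a set"
  edges :: "'a set set"

definition three_graph :: "'a hypergraph \<Rightarrow> bool" where
  "three_graph H \<longleftrightarrow> finite (verts H) \<and> edges H \<subseteq> [verts H]\<^bsup>3\<^esup>"

definition complete3 :: "nat \<Rightarrow> nat hypergraph" where
  "complete3 m = \<lparr>verts = {..<m}, edges = [{..<m}]\<^bsup>3\<^esup>\<rparr>"

text \<open>The distinguished vertex is \<open>0\<close>, the \<open>n\<close> further vertices are \<open>1, \<dots>, n\<close>.\<close>
definition star3 :: "nat \<Rightarrow> nat hypergraph" where
  "star3 n = \<lparr>verts = {..n}, edges = {e \<in> [{..n}]\<^bsup>3\<^esup>. 0 \<in> e}\<rparr>"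

text \<open>A copy is a (not necessarily induced) subgraph isomorphic to \<open>H\<close>.\<close>
definition contains_copy :: "'b hypergraph \<Rightarrow> 'a hypergraph \<Rightarrow> bool" where
  "contains_copy G H \<longleftrightarrow>
     (\<exists>f. inj_on f (verts H) \<and> f ` verts H \<subseteq> verts G \<and> (\<forall>e\<in>edges H. f ` e \<in> edges G))"

datatype colour = Red | Blue

definition colour_class :: "'a hypergraph \<Rightarrow> ('a set \<Rightarrow> colour) \<Rightarrow> colour \<Rightarrow> 'a hypergraph" where
  "colour_class G \<chi> k = \<lparr>verts = verts G, edges = {e \<in> edges G. \<chi> e = k}\<rparr>"

definition ramsey_prop :: "'a hypergraph \<Rightarrow> 'b hypergraph \<Rightarrow> nat \<Rightarrow> bool" where
  "ramsey_prop H1 H2 N \<longleftrightarrow>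
     (\<forall>\<chi>. contains_copy (colour_class (complete3 N) \<chi> Red) H1 \<or>
          contains_copy (colour_class (complete3 N) \<chi> Blue) H2)"

definition ramsey_number :: "'a hypergraph \<Rightarrow> 'b hypergraph \<Rightarrow> nat" where
  "ramsey_number H1 H2 = (LEAST N. ramsey_prop H1 H2 N)"

lemma three_graph_complete3: "three_graph (complete3 m)"
  by (simp add: three_graph_def complete3_def)

lemma three_graph_star3: "three_graph (star3 n)"
  by (auto simp: three_graph_def star3_def)

lemma card_edges_star3: "card (edges (star3 n)) = n choose 2"
proof -
  have "edges (star3 n) = insert 0 ` [{1..n}]\<^bsup>2\<^esup>"
  proof (intro equalityI subsetI)
    fix e assume e: "e \<in> edges (star3 n)"
    then have "e - {0} \<in> [{1..n}]\<^bsup>2\<^esup>" "e = insert 0 (e - {0})"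
      by (auto simp: star3_def nsets_def Suc_le_eq)
    then show "e \<in> insert 0 ` [{1..n}]\<^bsup>2\<^esup>" by blast
  next
    fix e assume "e \<in> insert 0 ` [{1..n}]\<^bsup>2\<^esup>"
    then obtain d where d: "e = insert 0 d" "d \<subseteq> {1..n}" "finite d" "card d = 2"
      by (auto simp: nsets_def)
    then have "0 \<notin> d" by auto
    with d show "e \<in> edges (star3 n)" by (auto simp: star3_def nsets_def)
  qed
  moreover have "inj_on (insert 0) ([{1..n}]\<^bsup>2\<^esup>)"
  proof (rule inj_onI)
    fix x y assume "x \<in> [{1..n}]\<^bsup>2\<^esup>" "y \<in> [{1..n}]\<^bsup>2\<^esup>" and eq: "insert 0 x = insert 0 y"
    then have "0 \<notin> x" "0 \<notin> y" by (auto simp: nsets_def)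
    with eq show "x = y" by (simp add: insert_ident)
  qed
  ultimately show ?thesis by (simp add: card_image)
qed

text \<open>The minimum in \<open>ramsey_number\<close> is attained, so it is not an underspecified \<open>LEAST\<close>.\<close>

lemma contains_copy_of_clique:
  assumes "three_graph H" "K \<subseteq> verts G" "finite K" "card K = card (verts H)" "[K]\<^bsup>3\<^esup> \<subseteq> edges G"
  shows "contains_copy G H"
proof -
  obtain f where f: "bij_betw f (verts H) K"
    using assms finite_same_card_bij unfolding three_graph_def by metis
  have "f ` e \<in> edges G" if "e \<in> edges H" for e
  proof -
    have "e \<in> [verts H]\<^bsup>3\<^esup>" using assms(1) that by (auto simp: three_graph_def)
    with f have "f ` e \<in> [K]\<^bsup>3\<^esup>"
      by (auto simp: nsets_def bij_betw_def card_image inj_on_subset)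
    with assms(5) show ?thesis by blast
  qed
  with f assms(2) show ?thesis
    unfolding contains_copy_def bij_betw_def by blast
qed

lemma ramsey_prop_ex:
  assumes "three_graph H1" "three_graph H2"
  shows "\<exists>N. ramsey_prop H1 H2 N"
proof -
  obtain N where N: "partn_lst {..<N::nat} [card (verts H1), card (verts H2)] 3"
    using ramsey_full by metis
  have "contains_copy (colour_class (complete3 N) \<chi> Red) H1 \<or>
        contains_copy (colour_class (complete3 N) \<chi> Blue) H2" for \<chi>
  proof -
    define g where "g = (\<lambda>e. if \<chi> e = Red then 0 else 1::nat)"
    have "g \<in> [{..<N}]\<^bsup>3\<^esup> \<rightarrow> {..<2}" by (auto simp: g_def)
    then obtain i K where i: "i < 2" and K: "K \<in> [{..<N}]\<^bsup>([card (verts H1), card (verts H2)] ! i)\<^esup>"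
      and g: "g ` [K]\<^bsup>3\<^esup> \<subseteq> {i}"
      using partn_lstE[OF N, of g 2] by (metis length_Cons list.size(3) numeral_2_eq_2)
    have sub: "[K]\<^bsup>3\<^esup> \<subseteq> [{..<N}]\<^bsup>3\<^esup>" using K by (intro nsets_mono) (auto simp: nsets_def)
    consider "i = 0" | "i = 1" using i by linarith
    then show ?thesis
    proof cases
      case 1
      then have "\<chi> e = Red" if "e \<in> [K]\<^bsup>3\<^esup>" for e
        using g that by (auto simp: g_def image_subset_iff split: if_splits)
      with 1 K sub have "contains_copy (colour_class (complete3 N) \<chi> Red) H1"
        by (intro contains_copy_of_clique[OF assms(1), of K])
           (auto simp: colour_class_def complete3_def nsets_def)
      then show ?thesis ..
    next
      case 2
      then have "\<chi> e = Blue" if "e \<in> [K]\<^bsup>3\<^esup>" for e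
        using g that colour.exhaust[of "\<chi> e"]
        by (auto simp: g_def image_subset_iff split: if_splits)
      with 2 K sub have "contains_copy (colour_class (complete3 N) \<chi> Blue) H2"
        by (intro contains_copy_of_clique[OF assms(2), of K])
           (auto simp: colour_class_def complete3_def nsets_def)
      then show ?thesis ..
    qed
  qed
  then show ?thesis unfolding ramsey_prop_def by blast
qed

lemma ramsey_prop_ramsey_number:
  assumes "three_graph H1" "three_graph H2"
  shows "ramsey_prop H1 H2 (ramsey_number H1 H2)"
  unfolding ramsey_number_def using ramsey_prop_ex[OF assms] by (rule LeastI_ex)

end

theory Submission
  imports Defs
begin

text \<open>
  Without a blue star \<open>S\<^sub>n\<close>, the red link graph of every vertex has independence number below \<open>n\<close>.

  For the upper bound with \<open>K\<^sub>s\<close>, expose vertices one at a time and shrink the set \<open>X\<close> of remaining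
  vertices to the most popular class of colours seen from a growing red clique \<open>W\<close>.  Each exposed
  vertex joins \<open>W\<close> or a blue star centred in \<open>W\<close>, and costs a factor depending only on \<open>s\<close>, so about
  \<open>s n\<close> steps suffice.  For the lower bound take a graph colouring \<open>\<phi>\<close> without large monochromatic
  sets and colour \<open>i < j < k\<close> red iff \<open>\<phi>(ij) \<noteq> \<phi>(jk)\<close>; this has no red \<open>K\<^sub>5\<close>.

  Lower bound for \<open>K\<^sub>4\<close>: a vertex \<open>v < 2\<^sup>d\<close>, \<open>d = D\<^sup>2\<close>, carries its binary digits and a codeword
  \<open>f v\<close> of length \<open>d\<close> over an alphabet of size \<open>4\<^sup>D\<close>, any two codewords agreeing in at most \<open>D\<close> positions.
  Let \<open>\<pi>(yz)\<close> be a position where the digits of \<open>y, z\<close> differ.  With random labels on the pairs,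
  a triple \<open>v | yz\<close> may be red because \<open>t(yz) = f v (\<pi>(yz))\<close>, or because for all positions \<open>p\<close> where \<open>f y\<close>
  and \<open>f z\<close> agree, the \<open>p\<close>-th digit of \<open>v\<close> is the bit \<open>\<epsilon>(yz, p)\<close>.  If \<open>i | kl\<close> and \<open>j | kl\<close> are red
  for the first reason then \<open>f i\<close> and \<open>f j\<close> agree at \<open>\<pi>(kl)\<close>, where \<open>k\<close> and \<open>l\<close> have different digits,
  so \<open>k | ij\<close> and \<open>l | ij\<close> cannot both be red for the second reason.  A labelling of the pairs by
  residues modulo 3 excludes every other kind of red \<open>K\<^sub>4\<close>.  Both reasons have probability
  at least \<open>4\<^bsup>-D\<^esup> / 3\<close>, independently over the pairs \<open>yz\<close>, so there is no blue star with \<open>2\<^bsup>12 D\<^esup>\<close> leaves.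

  Upper bound for \<open>K\<^sub>4\<close>: let \<open>C\<close> be about \<open>n\<^bsup>1/3\<^esup>\<close> and \<open>k = 8 C + 1\<close>.  A pigeonhole argument gives a set
  \<open>K\<close> of \<open>k\<close> vertices and a large set \<open>R\<close> such that \<open>a, b, x\<close> is red for all \<open>a, b \<in> K\<close>, \<open>x \<in> R\<close>.  Then the
  red links of the vertices of \<open>K\<close> are edge disjoint on \<open>R\<close>.  Split \<open>R\<close> into \<open>C\<close> parts and let \<open>a \<in> K\<close> have a
  link of density at most about \<open>1/k\<close> between the parts.  Every large subset of \<open>R\<close> contains a clique
  of size \<open>s = 16 C\<^sup>2\<close> in the link of a fixed other vertex, which is independent in the link of \<open>a\<close>.
  Pick such a set in the first part, restrict each later part to a class of vertices with
  the same neighbours in it, and iterate.  Random classes preserve the expected densities, so in total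
  few vertices have neighbours in other parts, and the union of what is left is an independent set
  of at least \<open>n\<close> vertices in the link of \<open>a\<close>.
\<close>

section \<open>Ramsey numbers of cliques versus stars\<close>

lemma contains_copy_complete3_iff:
  "contains_copy (colour_class (complete3 N) \<chi> k) (complete3 s) \<longleftrightarrow>
     (\<exists>K\<subseteq>{..<N}. card K = s \<and> (\<forall>e\<in>[K]\<^bsup>3\<^esup>. \<chi> e = k))"
proof
  assume "contains_copy (colour_class (complete3 N) \<chi> k) (complete3 s)"
  then obtain f where f: "inj_on f {..<s}" "f ` {..<s} \<subseteq> {..<N}"
      and red: "\<forall>e\<in>[{..<s}]\<^bsup>3\<^esup>. \<chi> (f ` e) = k"
    by (auto simp: contains_copy_def colour_class_def complete3_def)
  have "\<chi> e = k" if "e \<in> [f ` {..<s}]\<^bsup>3\<^esup>" for e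
    using that red f(1) by (metis nset_image_obtains)
  with f show "\<exists>K\<subseteq>{..<N}. card K = s \<and> (\<forall>e\<in>[K]\<^bsup>3\<^esup>. \<chi> e = k)"
    by (metis card_image card_lessThan)
next
  assume "\<exists>K\<subseteq>{..<N}. card K = s \<and> (\<forall>e\<in>[K]\<^bsup>3\<^esup>. \<chi> e = k)"
  then obtain K where K: "K \<subseteq> {..<N}" "card K = s" "\<forall>e\<in>[K]\<^bsup>3\<^esup>. \<chi> e = k" by blast
  then show "contains_copy (colour_class (complete3 N) \<chi> k) (complete3 s)"
    using finite_subset[OF K(1)] nsets_mono[OF K(1), of 3]
    by (intro contains_copy_of_clique[OF three_graph_complete3, of K])
       (auto simp: colour_class_def complete3_def)
qed

lemma contains_copy_star3_iff:
  "contains_copy (colour_class (complete3 N) \<chi> k) (star3 n) \<longleftrightarrow>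
     (\<exists>v<N. \<exists>S\<subseteq>{..<N} - {v}. card S = n \<and> (\<forall>x\<in>S. \<forall>y\<in>S. x \<noteq> y \<longrightarrow> \<chi> {v, x, y} = k))"
proof
  assume "contains_copy (colour_class (complete3 N) \<chi> k) (star3 n)"
  then obtain f where f: "inj_on f {..n}" "f ` {..n} \<subseteq> {..<N}"
      and col: "\<forall>e\<in>[{..n}]\<^bsup>3\<^esup>. 0 \<in> e \<longrightarrow> \<chi> (f ` e) = k"
    by (auto simp: contains_copy_def colour_class_def complete3_def star3_def)
  let ?S = "f ` {1..n}"
  have "\<chi> {f 0, f x, f y} = k" if "x \<in> {1..n}" "y \<in> {1..n}" "x \<noteq> y" for x y
  proof -
    have "{0, x, y} \<in> [{..n}]\<^bsup>3\<^esup>" using that by (auto simp: nsets_def)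
    with col have "\<chi> (f ` {0, x, y}) = k" by blast
    then show ?thesis by simp
  qed
  moreover have "?S \<subseteq> {..<N} - {f 0}" using f(2) inj_onD[OF f(1), of _ 0] by fastforce
  moreover have "card ?S = n"
    using card_image[of f "{1..n}"] inj_on_subset[OF f(1), of "{1..n}"] by auto
  moreover have "f 0 < N" using f by auto
  ultimately show "\<exists>v<N. \<exists>S\<subseteq>{..<N} - {v}. card S = n \<and>
      (\<forall>x\<in>S. \<forall>y\<in>S. x \<noteq> y \<longrightarrow> \<chi> {v, x, y} = k)"
    by (intro exI[of _ "f 0"] conjI exI[of _ ?S]) (auto, metis)
next
  assume "\<exists>v<N. \<exists>S\<subseteq>{..<N} - {v}. card S = n \<and> (\<forall>x\<in>S. \<forall>y\<in>S. x \<noteq> y \<longrightarrow> \<chi> {v, x, y} = k)"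
  then obtain v S where v: "v < N" and S: "S \<subseteq> {..<N} - {v}" "card S = n"
      and col: "\<forall>x\<in>S. \<forall>y\<in>S. x \<noteq> y \<longrightarrow> \<chi> {v, x, y} = k" by blast
  have "finite S" using S finite_subset by blast
  then obtain g where g: "bij_betw g {1..n} S"
    using finite_same_card_bij[of "{1..n}" S] S(2) by auto
  define f where "f i = (if i = 0 then v else g i)" for i
  have gS: "g i \<in> S" if "i \<in> {1..n}" for i using bij_betw_apply[OF g that] .
  have gI: "g i = g j \<longleftrightarrow> i = j" if "i \<in> {1..n}" "j \<in> {1..n}" for i j
    using bij_betw_imp_inj_on[OF g] that by (rule inj_on_eq_iff)
  have inj: "inj_on f {..n}"
  proof (rule inj_onI)
    fix i j assume "i \<in> {..n}" "j \<in> {..n}" "f i = f j"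
    then show "i = j"
      using gS[of i] gS[of j] gI[of i j] S by (cases "i = 0"; cases "j = 0") (auto simp: f_def Suc_le_eq)
  qed
  have rng: "f ` {..n} \<subseteq> {..<N}" using gS S v by (fastforce simp: f_def Suc_le_eq)
  have "\<chi> (f ` e) = k \<and> f ` e \<in> [{..<N}]\<^bsup>3\<^esup>" if e: "e \<in> [{..n}]\<^bsup>3\<^esup>" "0 \<in> e" for e
  proof
    from e have "card (e - {0}) = 2" "e \<subseteq> {..n}" "finite e" by (auto simp: nsets_def)
    then obtain x y where xy: "e - {0} = {x, y}" "x \<noteq> y" by (meson card_2_iff)
    with e have e': "e = {0, x, y}" by blast
    have "x \<in> {..n} - {0}" "y \<in> {..n} - {0}" using xy \<open>e \<subseteq> {..n}\<close> by blast+
    then have "x \<in> {1..n}" "y \<in> {1..n}" by auto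
    moreover from this have "f ` e = {v, g x, g y}" by (auto simp: e' f_def)
    ultimately show "\<chi> (f ` e) = k"
      using col gS[of x] gS[of y] xy(2) gI[of x y] by simp
    show "f ` e \<in> [{..<N}]\<^bsup>3\<^esup>"
      using e inj rng by (auto simp: nsets_def card_image inj_on_subset image_subset_iff)
  qed
  with inj rng show "contains_copy (colour_class (complete3 N) \<chi> k) (star3 n)"
    unfolding contains_copy_def
    by (intro exI[of _ f]) (auto simp: colour_class_def complete3_def star3_def)
qed

lemma ramsey_prop_iff:
  "ramsey_prop (complete3 s) (star3 n) N \<longleftrightarrow>
     (\<forall>\<chi>. (\<exists>K\<subseteq>{..<N}. card K = s \<and> (\<forall>e\<in>[K]\<^bsup>3\<^esup>. \<chi> e = Red)) \<or>
          (\<exists>v<N. \<exists>S\<subseteq>{..<N} - {v}. card S = n \<and> (\<forall>x\<in>S. \<forall>y\<in>S. x \<noteq> y \<longrightarrow> \<chi> {v, x, y} = Blue)))"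
  unfolding ramsey_prop_def contains_copy_complete3_iff contains_copy_star3_iff ..

lemma contains_copy_mono:
  assumes "contains_copy (colour_class (complete3 M) \<chi> k) H" "M \<le> N"
  shows "contains_copy (colour_class (complete3 N) \<chi> k) H"
proof -
  have sub: "[{..<M}]\<^bsup>3\<^esup> \<subseteq> [{..<N}]\<^bsup>3\<^esup>" using assms(2) by (intro nsets_mono) auto
  from assms(1) obtain f where f: "inj_on f (verts H)" "f ` verts H \<subseteq> {..<M}"
      and e: "\<forall>e\<in>edges H. f ` e \<in> [{..<M}]\<^bsup>3\<^esup> \<and> \<chi> (f ` e) = k"
    by (auto simp: contains_copy_def colour_class_def complete3_def)
  have "f ` verts H \<subseteq> {..<N}" using f(2) assms(2) by fastforce
  moreover have "\<forall>e\<in>edges H. f ` e \<in> [{..<N}]\<^bsup>3\<^esup> \<and> \<chi> (f ` e) = k"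
    using e sub by blast
  ultimately show ?thesis
    using f(1) by (simp add: contains_copy_def colour_class_def complete3_def) blast
qed

lemma ramsey_prop_mono:
  "ramsey_prop H1 H2 M \<Longrightarrow> M \<le> N \<Longrightarrow> ramsey_prop H1 H2 N"
  unfolding ramsey_prop_def using contains_copy_mono by metis

lemma less_ramsey_number:
  assumes "\<not> ramsey_prop (complete3 s) (star3 n) N"
  shows "N < ramsey_number (complete3 s) (star3 n)"
proof (rule ccontr)
  assume "\<not> ?thesis"
  then have "ramsey_prop (complete3 s) (star3 n) N"
    by (intro ramsey_prop_mono[OF ramsey_prop_ramsey_number[OF three_graph_complete3 three_graph_star3]])
       simp
  with assms show False ..
qed

lemma ramsey_number_le:
  "ramsey_prop H1 H2 N \<Longrightarrow> ramsey_number H1 H2 \<le> N"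
  unfolding ramsey_number_def by (rule Least_le)

lemma pigeonhole_card_vimage:
  assumes "finite X" "finite T" "f ` X \<subseteq> T" "T \<noteq> {}"
  obtains t where "t \<in> T" "card X \<le> card T * card {x \<in> X. f x = t}"
proof (rule ccontr)
  assume "\<not> thesis"
  with that have less: "card T * card {x \<in> X. f x = t} < card X" if "t \<in> T" for t
    using \<open>t \<in> T\<close> by (meson not_less)
  have "card X = (\<Sum>t\<in>T. card {x \<in> X. f x = t})"
    using sum.group[OF assms(1-3), of "\<lambda>_. 1::nat"] by simp
  then have "card T * card X = (\<Sum>t\<in>T. card T * card {x \<in> X. f x = t})"
    by (simp add: sum_distrib_left)
  also have "\<dots> < (\<Sum>t\<in>T. card X)"
    using assms(2,4) less by (intro sum_strict_mono) auto
  finally show False by simp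
qed

section \<open>The upper bound for general cliques\<close>

text \<open>\<open>W\<close> is the red clique under construction, \<open>B w\<close> the leaves of the blue star centred at \<open>w\<close>, and \<open>X\<close>
  the set of unexposed vertices; \<open>T\<close> bounds the number of steps left.\<close>

lemma red_clique_or_blue_star:
  fixes \<chi> :: "'a set \<Rightarrow> colour"
  assumes "(2 ^ Suc s) ^ T \<le> card X" "card W \<le> s" "W \<subseteq> V" "X \<subseteq> V" "finite V" "W \<inter> X = {}"
    and "\<And>e. e \<in> [W]\<^bsup>3\<^esup> \<Longrightarrow> \<chi> e = Red"
    and "\<And>u w x. u \<in> W \<Longrightarrow> w \<in> W \<Longrightarrow> u \<noteq> w \<Longrightarrow> x \<in> X \<Longrightarrow> \<chi> {u, w, x} = Red"
    and "\<And>w. w \<in> W \<Longrightarrow> B w \<subseteq> V - {w} \<and> B w \<inter> X = {} \<and> card (B w) \<le> n"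
    and "\<And>w x y. w \<in> W \<Longrightarrow> x \<in> B w \<Longrightarrow> y \<in> B w \<Longrightarrow> x \<noteq> y \<Longrightarrow> \<chi> {w, x, y} = Blue"
    and "\<And>w x y. w \<in> W \<Longrightarrow> x \<in> B w \<Longrightarrow> y \<in> X \<Longrightarrow> \<chi> {w, x, y} = Blue"
    and "(s - card W) * Suc n + (\<Sum>w\<in>W. n - card (B w)) \<le> T"
  shows "(\<exists>K\<subseteq>V. card K = s \<and> (\<forall>e\<in>[K]\<^bsup>3\<^esup>. \<chi> e = Red)) \<or>
    (\<exists>v\<in>V. \<exists>S\<subseteq>V - {v}. card S = n \<and> (\<forall>x\<in>S. \<forall>y\<in>S. x \<noteq> y \<longrightarrow> \<chi> {v, x, y} = Blue))"
  using assms
proof (induction T arbitrary: X W B)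
  case 0
  \<comment> \<open>A zero budget forces \<open>s - card W = 0\<close>, so \<open>W\<close> is
    already the red clique.\<close>
  then show ?case by (intro disjI1 exI[of _ W]) auto
next
  case (Suc T)
  have fin: "finite W" "finite X" "\<And>w. w \<in> W \<Longrightarrow> finite (B w)"
    using Suc.prems(3-5,9) by (meson finite_subset finite_Diff)+
  show ?case
  proof (cases "card W = s \<or> (\<exists>w\<in>W. card (B w) = n)")
    case True
    then show ?thesis
    proof
      assume "card W = s"
      with Suc.prems(3,7) show ?thesis by blast
    next
      assume "\<exists>w\<in>W. card (B w) = n"
      then obtain w where w: "w \<in> W" "card (B w) = n" ..
      then show ?thesis
        using Suc.prems(3,9,10) by (intro disjI2 bexI[of _ w] exI[of _ "B w"]) auto
    qed
  next
    case False
    then have W_less: "card W < s" and B_less: "\<And>w. w \<in> W \<Longrightarrow> card (B w) < n"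
      using Suc.prems(2,9) by (auto simp: order.order_iff_strict)
    have "0 < card X" using Suc.prems(1) by (metis gr0I le_zero_eq power_eq_0_iff zero_neq_numeral)
    then obtain v where v: "v \<in> X" by (metis card_gt_0_iff ex_in_conv)
    \<comment> \<open>The pattern of \<open>x\<close> is the set of those \<open>w\<close> in
      \<open>W\<close> that form a red triple with \<open>v\<close> and \<open>x\<close>; at most
      \<open>2 ^ s\<close> patterns occur.\<close>
    obtain P where P: "P \<in> Pow W"
      and card_P: "card (X - {v}) \<le> card (Pow W) * card {x \<in> X - {v}. {w \<in> W. \<chi> {w, v, x} = Red} = P}"
      using pigeonhole_card_vimage[of "X - {v}" "Pow W" "\<lambda>x. {w \<in> W. \<chi> {w, v, x} = Red}"] fin
      by auto
    define Y where "Y = {x \<in> X - {v}. {w \<in> W. \<chi> {w, v, x} = Red} = P}"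
    have Y: "Y \<subseteq> X - {v}" by (auto simp: Y_def)
    \<comment> \<open>Of the factor \<open>2 ^ Suc s\<close>, the part \<open>2 ^ s\<close> pays for
      the pigeonhole and the remaining 2 for the removal of \<open>v\<close>.\<close>
    have size: "(2 ^ Suc s) ^ T \<le> card Y"
    proof (rule ccontr)
      define M :: nat where "M = (2 ^ Suc s) ^ T"
      define p :: nat where "p = 2 ^ s"
      assume "\<not> ?thesis"
      then have "Suc (card Y) \<le> M" by (simp add: M_def)
      then have "p * Suc (card Y) \<le> p * M" by (rule mult_le_mono2)
      moreover have "card X - 1 \<le> p * card Y"
      proof -
        have "card X - 1 \<le> 2 ^ card W * card Y"
          using card_P v fin by (simp add: Y_def card_Pow)
        also have "\<dots> \<le> p * card Y"
          using Suc.prems(2) unfolding p_def by (intro mult_le_mono1 power_increasing) auto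
        finally show ?thesis .
      qed
      moreover have "2 * (p * M) \<le> card X" using Suc.prems(1) by (simp add: M_def p_def)
      moreover have "p * M \<ge> 1" "p \<ge> 1" by (simp_all add: M_def p_def)
      ultimately show False unfolding mult_Suc_right by linarith
    qed
    show ?thesis
    \<comment> \<open>Either \<open>v\<close> forms red triples with all of \<open>W\<close> and
      joins the clique, or some \<open>w\<close> outside \<open>P\<close> gains the leaf
      \<open>v\<close>, because all triples from \<open>w\<close> and \<open>v\<close> into
      \<open>Y\<close> are blue.\<close>
    proof (cases "P = W")
      case True
      have red: "\<chi> {w, v, x} = Red" if "w \<in> W" "x \<in> Y" for w x
        using that True by (auto simp: Y_def)
      have vW: "v \<notin> W" using v Suc.prems(6) by blast
      show ?thesis
      proof (rule Suc.IH[of Y "insert v W" "B(v := {})"])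
        show "(B(v := {})) w \<subseteq> V - {w} \<and> (B(v := {})) w \<inter> Y = {} \<and> card ((B(v := {})) w) \<le> n"
          if "w \<in> insert v W" for w
          using Suc.prems(9)[of w] that Y by (cases "w = v") auto
        show "\<chi> {w, x, y} = Blue" if "w \<in> insert v W" "x \<in> (B(v := {})) w"
            "y \<in> (B(v := {})) w" "x \<noteq> y" for w x y
          using Suc.prems(10)[of w x y] that by (cases "w = v") auto
        show "\<chi> {w, x, y} = Blue" if "w \<in> insert v W" "x \<in> (B(v := {})) w" "y \<in> Y" for w x y
          using Suc.prems(11)[of w x y] that Y by (cases "w = v") auto
        show "\<chi> e = Red" if "e \<in> [insert v W]\<^bsup>3\<^esup>" for e
        proof (cases "v \<in> e")
          case False
          with that have "e \<in> [W]\<^bsup>3\<^esup>" by (auto simp: nsets_def)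
          then show ?thesis by (rule Suc.prems(7))
        next
          case True
          with that have "card (e - {v}) = 2" "e - {v} \<subseteq> W" by (auto simp: nsets_def)
          then obtain x y where "e - {v} = {x, y}" "x \<noteq> y" "x \<in> W" "y \<in> W"
            by (metis card_2_iff insert_subset)
          moreover from this True have "e = {x, y, v}" by blast
          ultimately show ?thesis using Suc.prems(8) v by blast
        qed
        show "\<chi> {u, w, x} = Red"
          if uwx: "u \<in> insert v W" "w \<in> insert v W" "u \<noteq> w" "x \<in> Y" for u w x
        proof -
          consider "u = v" "w \<in> W" | "w = v" "u \<in> W" | "u \<in> W" "w \<in> W" using uwx by blast
          then show ?thesis
          proof cases
            case 1
            then show ?thesis using red[of w x] uwx by (simp add: insert_commute)
          next
            case 2
            then show ?thesis using red[of u x] uwx by simp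
          next
            case 3
            then show ?thesis using Suc.prems(8) uwx Y by blast
          qed
        qed
        \<comment> \<open>A new clique vertex releases \<open>Suc n\<close> from the first term and
          its empty star takes back \<open>n\<close>, so the budget drops by one.\<close>
        show "(s - card (insert v W)) * Suc n + (\<Sum>w\<in>insert v W. n - card ((B(v := {})) w)) \<le> T"
        proof -
          have "(\<Sum>w\<in>insert v W. n - card ((B(v := {})) w)) = n + (\<Sum>w\<in>W. n - card (B w))"
            using vW fin by (auto intro!: sum.cong)
          moreover have "(s - card W) * Suc n = Suc n + (s - Suc (card W)) * Suc n"
            using W_less by (metis Suc_diff_Suc mult_Suc)
          ultimately show ?thesis using Suc.prems(12) vW fin by simp
        qed
      qed (use Suc.prems W_less size v Y vW fin in auto)
    next
      case False
      with P obtain w where w: "w \<in> W" "w \<notin> P" by blast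
      have blue: "\<chi> {w, v, x} = Blue" if "x \<in> Y" for x
        using that w colour.exhaust[of "\<chi> {w, v, x}"] by (auto simp: Y_def)
      have vB: "v \<notin> B w" using v Suc.prems(9)[OF w(1)] by blast
      have vw: "v \<noteq> w" using v w Suc.prems(6) by blast
      show ?thesis
      proof (rule Suc.IH[of Y W "B(w := insert v (B w))"])
        show "(B(w := insert v (B w))) u \<subseteq> V - {u} \<and> (B(w := insert v (B w))) u \<inter> Y = {} \<and>
            card ((B(w := insert v (B w))) u) \<le> n" if "u \<in> W" for u
          using Suc.prems(9)[OF that] Suc.prems(4) v vw Y B_less[OF that] vB fin(3)[OF that]
          by (auto simp: Suc_le_eq)
        show "\<chi> {u, x, y} = Blue" if uxy: "u \<in> W" "x \<in> (B(w := insert v (B w))) u"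
          "y \<in> (B(w := insert v (B w))) u" "x \<noteq> y" for u x y
        proof (cases "u = w \<and> (x = v \<or> y = v)")
          case True
          then consider "u = w" "x = v" "y \<in> B w" | "u = w" "y = v" "x \<in> B w"
            using uxy by auto
          then show ?thesis
          proof cases
            case 1
            then show ?thesis using Suc.prems(11)[of w y v] w v by (simp add: insert_commute)
          next
            case 2
            then show ?thesis using Suc.prems(11)[of w x v] w v by simp
          qed
        next
          case False
          with uxy show ?thesis using Suc.prems(10)[of u x y] by (auto split: if_splits)
        qed
        show "\<chi> {u, x, y} = Blue" if "u \<in> W" "x \<in> (B(w := insert v (B w))) u" "y \<in> Y" for u x y
          using that blue Suc.prems(11)[of u x y] Y by (auto split: if_splits)
        show "(s - card W) * Suc n + (\<Sum>u\<in>W. n - card ((B(w := insert v (B w))) u)) \<le> T"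
        proof -
          have "(\<Sum>u\<in>W. n - card ((B(w := insert v (B w))) u)) < (\<Sum>u\<in>W. n - card (B u))"
            using w fin vB B_less by (intro sum_strict_mono_ex1) (auto intro!: bexI[of _ w] diff_less_mono2)
          then show ?thesis using Suc.prems(12) by simp
        qed
      qed (use Suc.prems W_less size v Y in auto)
    qed
  qed
qed

text \<open>The exposure starts from \<open>W = {}\<close> with the budget \<open>s * Suc n\<close>,
  and each step costs a factor \<open>2 ^ Suc s\<close>.\<close>

lemma ramsey_number_clique_star_upper:
  "ramsey_number (complete3 s) (star3 n) \<le> 2 ^ (Suc s * (s * Suc n))"
proof (rule ramsey_number_le, unfold ramsey_prop_iff, rule allI)
  fix \<chi> :: "nat set \<Rightarrow> colour"
  let ?N = "2 ^ (Suc s * (s * Suc n)) :: nat"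
  show "(\<exists>K\<subseteq>{..<?N}. card K = s \<and> (\<forall>e\<in>[K]\<^bsup>3\<^esup>. \<chi> e = Red)) \<or>
    (\<exists>v<?N. \<exists>S\<subseteq>{..<?N} - {v}. card S = n \<and> (\<forall>x\<in>S. \<forall>y\<in>S. x \<noteq> y \<longrightarrow> \<chi> {v, x, y} = Blue))"
  proof -
    have "(2 ^ Suc s) ^ (s * Suc n) \<le> card {..<?N}" by (simp only: power_mult card_lessThan)
    then have "(\<exists>K\<subseteq>{..<?N}. card K = s \<and> (\<forall>e\<in>[K]\<^bsup>3\<^esup>. \<chi> e = Red)) \<or>
        (\<exists>v\<in>{..<?N}. \<exists>S\<subseteq>{..<?N} - {v}. card S = n \<and> (\<forall>x\<in>S. \<forall>y\<in>S. x \<noteq> y \<longrightarrow> \<chi> {v, x, y} = Blue))"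
      by (rule red_clique_or_blue_star[where W = "{}" and B = "\<lambda>_. {}"]) (auto simp: nsets_empty_iff)
    then show ?thesis by (simp only: Bex_def lessThan_iff)
  qed
qed

section \<open>Random labellings and the lower bound for five vertices\<close>

text \<open>First-moment argument by counting: a uniform labelling misses \<open>G \<tau> e\<close>
  with probability at most \<open>1 - 1 / K\<close>, independently for the \<open>h choose 2\<close>
  pairs \<open>e\<close> of a fixed \<open>h\<close>-set. The last hypothesis says that the union
  bound over \<open>T\<close> and all \<open>h\<close>-sets stays below 1.\<close>

lemma exists_labelling_hitting_all_subsets:
  fixes G :: "'t \<Rightarrow> 'v set \<Rightarrow> 'l set" and K :: real
  assumes "finite V" "finite \<Theta>" "\<Theta> \<noteq> {}" "finite T" "K \<ge> 1"
    and G: "\<And>\<tau> e. \<tau> \<in> T \<Longrightarrow> e \<in> [V]\<^bsup>2\<^esup> \<Longrightarrow> G \<tau> e \<subseteq> \<Theta> \<and> real (card \<Theta>) \<le> K * real (card (G \<tau> e))"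
    and less: "real (card T) * real (card V choose h) * (1 - 1 / K) ^ (h choose 2) < 1"
  shows "\<exists>\<theta>\<in>[V]\<^bsup>2\<^esup> \<rightarrow>\<^sub>E \<Theta>. \<forall>\<tau>\<in>T. \<forall>S\<in>[V]\<^bsup>h\<^esup>. \<exists>e\<in>[S]\<^bsup>2\<^esup>. \<theta> e \<in> G \<tau> e"
proof -
  define \<Omega> where "\<Omega> = [V]\<^bsup>2\<^esup> \<rightarrow>\<^sub>E \<Theta>"
  define bad where "bad \<tau> S = (\<Pi>\<^sub>E e\<in>[V]\<^bsup>2\<^esup>. if e \<in> [S]\<^bsup>2\<^esup> then \<Theta> - G \<tau> e else \<Theta>)" for \<tau> S
  have fin: "finite ([V]\<^bsup>2\<^esup>)" "finite ([V]\<^bsup>h\<^esup>)" using assms(1) by (simp_all add: finite_imp_finite_nsets)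
  have \<Omega>_pos: "card \<Omega> > 0" "finite \<Omega>"
    using fin assms(2,3) by (auto simp: \<Omega>_def card_PiE finite_PiE card_gt_0_iff prod_pos)
  have bad_le: "real (card (bad \<tau> S)) \<le> (1 - 1 / K) ^ (h choose 2) * real (card \<Omega>)"
    if \<tau>: "\<tau> \<in> T" and S: "S \<in> [V]\<^bsup>h\<^esup>" for \<tau> S
  proof -
    have sub: "[S]\<^bsup>2\<^esup> \<subseteq> [V]\<^bsup>2\<^esup>" and cS: "card S = h" using S by (auto simp: nsets_def)
    have "real (card (bad \<tau> S)) =
        (\<Prod>e\<in>[V]\<^bsup>2\<^esup>. real (card (if e \<in> [S]\<^bsup>2\<^esup> then \<Theta> - G \<tau> e else \<Theta>)))"
      using fin by (simp add: bad_def card_PiE)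
    also have "\<dots> \<le> (\<Prod>e\<in>[V]\<^bsup>2\<^esup>. (if e \<in> [S]\<^bsup>2\<^esup> then 1 - 1 / K else 1) * real (card \<Theta>))"
    proof (intro prod_mono conjI)
      fix e assume e: "e \<in> [V]\<^bsup>2\<^esup>"
      have "real (card (\<Theta> - G \<tau> e)) \<le> (1 - 1 / K) * real (card \<Theta>)"
      proof -
        have "real (card (\<Theta> - G \<tau> e)) = real (card \<Theta>) - real (card (G \<tau> e))"
          using G[OF \<tau> e] assms(2) finite_subset[of "G \<tau> e" \<Theta>] card_mono[of \<Theta> "G \<tau> e"]
          by (simp add: card_Diff_subset of_nat_diff)
        moreover have "real (card \<Theta>) / K \<le> real (card (G \<tau> e))"
          using G[OF \<tau> e] assms(5) by (simp add: divide_simps mult.commute)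
        ultimately show ?thesis by (simp add: algebra_simps)
      qed
      then show "real (card (if e \<in> [S]\<^bsup>2\<^esup> then \<Theta> - G \<tau> e else \<Theta>))
          \<le> (if e \<in> [S]\<^bsup>2\<^esup> then 1 - 1 / K else 1) * real (card \<Theta>)" by simp
    qed simp
    also have "\<dots> = (\<Prod>e\<in>[V]\<^bsup>2\<^esup>. if e \<in> [S]\<^bsup>2\<^esup> then 1 - 1 / K else 1) * real (card \<Omega>)"
      using fin by (simp add: prod.distrib \<Omega>_def card_PiE)
    also have "(\<Prod>e\<in>[V]\<^bsup>2\<^esup>. if e \<in> [S]\<^bsup>2\<^esup> then 1 - 1 / K else 1) = (1 - 1 / K) ^ card ([S]\<^bsup>2\<^esup>)"
      using prod.mono_neutral_cong_right[OF fin(1) sub,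
          of "\<lambda>e. if e \<in> [S]\<^bsup>2\<^esup> then 1 - 1 / K else 1" "\<lambda>_. 1 - 1 / K"] by simp
    finally show ?thesis by (simp add: cS)
  qed
  have "real (card (\<Union>\<tau>\<in>T. \<Union>S\<in>[V]\<^bsup>h\<^esup>. bad \<tau> S)) \<le> (\<Sum>\<tau>\<in>T. \<Sum>S\<in>[V]\<^bsup>h\<^esup>. real (card (bad \<tau> S)))"
  proof -
    have "card (\<Union>\<tau>\<in>T. \<Union>S\<in>[V]\<^bsup>h\<^esup>. bad \<tau> S) \<le> (\<Sum>\<tau>\<in>T. card (\<Union>S\<in>[V]\<^bsup>h\<^esup>. bad \<tau> S))"
      by (rule card_UN_le[OF assms(4)])
    also have "\<dots> \<le> (\<Sum>\<tau>\<in>T. \<Sum>S\<in>[V]\<^bsup>h\<^esup>. card (bad \<tau> S))"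
      by (intro sum_mono card_UN_le fin)
    finally show ?thesis by (simp flip: of_nat_sum)
  qed
  also have "\<dots> \<le> (\<Sum>\<tau>\<in>T. \<Sum>S\<in>[V]\<^bsup>h\<^esup>. (1 - 1 / K) ^ (h choose 2) * real (card \<Omega>))"
    by (intro sum_mono bad_le)
  also have "\<dots> = real (card T) * real (card V choose h) * (1 - 1 / K) ^ (h choose 2) * real (card \<Omega>)"
    by simp
  also have "\<dots> < 1 * real (card \<Omega>)" using less \<Omega>_pos by (intro mult_strict_right_mono) auto
  finally have "\<not> \<Omega> \<subseteq> (\<Union>\<tau>\<in>T. \<Union>S\<in>[V]\<^bsup>h\<^esup>. bad \<tau> S)"
    using fin assms(2,4) card_mono[of "\<Union>\<tau>\<in>T. \<Union>S\<in>[V]\<^bsup>h\<^esup>. bad \<tau> S" \<Omega>]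
    by (auto simp: bad_def finite_PiE)
  then obtain \<theta> where \<theta>: "\<theta> \<in> \<Omega>" "\<And>\<tau> S. \<tau> \<in> T \<Longrightarrow> S \<in> [V]\<^bsup>h\<^esup> \<Longrightarrow> \<theta> \<notin> bad \<tau> S" by blast
  have "\<exists>e\<in>[S]\<^bsup>2\<^esup>. \<theta> e \<in> G \<tau> e" if "\<tau> \<in> T" "S \<in> [V]\<^bsup>h\<^esup>" for \<tau> S
    using \<theta>(2)[OF that] \<theta>(1) unfolding bad_def \<Omega>_def PiE_iff by (auto split: if_splits)
  then show ?thesis using \<theta>(1) unfolding \<Omega>_def by blast
qed

text \<open>Logarithmic form for the applications, from \<open>1 - x \<le> exp (- x)\<close> and
  \<open>N choose h \<le> N ^ h\<close>. Larger sets inherit the hit from a subset of size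
  \<open>h\<close>.\<close>

lemma exists_labelling:
  fixes G :: "'t \<Rightarrow> 'v set \<Rightarrow> 'l set" and K :: real
  assumes "finite V" "V \<noteq> {}" "finite \<Theta>" "\<Theta> \<noteq> {}" "finite T" "T \<noteq> {}" "K \<ge> 1"
    and G: "\<And>\<tau> e. \<tau> \<in> T \<Longrightarrow> e \<in> [V]\<^bsup>2\<^esup> \<Longrightarrow> G \<tau> e \<subseteq> \<Theta> \<and> real (card \<Theta>) \<le> K * real (card (G \<tau> e))"
    and less: "ln (real (card T)) + real h * ln (real (card V)) < real h * (real h - 1) / (2 * K)"
  obtains \<theta> where "\<theta> \<in> [V]\<^bsup>2\<^esup> \<rightarrow>\<^sub>E \<Theta>"
    "\<And>\<tau> S. \<tau> \<in> T \<Longrightarrow> S \<subseteq> V \<Longrightarrow> h \<le> card S \<Longrightarrow> \<exists>e\<in>[S]\<^bsup>2\<^esup>. \<theta> e \<in> G \<tau> e"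
proof -
  have pos: "real (card T) > 0" "real (card V) > 0" using assms by (auto simp: card_gt_0_iff)
  have h2: "real (h choose 2) = real h * (real h - 1) / 2"
    by (cases h) (simp_all add: choose_two real_of_nat_div field_simps)
  have "(1 - 1 / K) ^ (h choose 2) \<le> exp (- (1 / K)) ^ (h choose 2)"
    using assms(7) exp_ge_add_one_self[of "- (1 / K)"] by (intro power_mono) auto
  also have "\<dots> = exp (- (real h * (real h - 1) / (2 * K)))"
    by (simp add: h2 flip: exp_of_nat_mult)
  finally have "(1 - 1 / K) ^ (h choose 2) \<le> exp (- (real h * (real h - 1) / (2 * K)))" .
  moreover have "real (card V choose h) \<le> real (card V) ^ h"
  proof (cases "h \<le> card V")
    case True
    then show ?thesis using binomial_le_pow[OF True] by (simp flip: of_nat_power)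
  qed (simp add: binomial_eq_0)
  ultimately have "real (card T) * real (card V choose h) * (1 - 1 / K) ^ (h choose 2) \<le>
      real (card T) * real (card V) ^ h * exp (- (real h * (real h - 1) / (2 * K)))"
    using assms(7) by (intro mult_mono) auto
  also have "\<dots> = exp (ln (real (card T)) + real h * ln (real (card V)) - real h * (real h - 1) / (2 * K))"
    using pos by (simp add: exp_add exp_diff exp_minus exp_of_nat_mult field_simps)
  also have "\<dots> < 1" using less by simp
  finally have "real (card T) * real (card V choose h) * (1 - 1 / K) ^ (h choose 2) < 1" .
  then have "\<exists>\<theta>\<in>[V]\<^bsup>2\<^esup> \<rightarrow>\<^sub>E \<Theta>. \<forall>\<tau>\<in>T. \<forall>S\<in>[V]\<^bsup>h\<^esup>. \<exists>e\<in>[S]\<^bsup>2\<^esup>. \<theta> e \<in> G \<tau> e"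
    using G by (intro exists_labelling_hitting_all_subsets[OF assms(1,3,4,5,7)])
  then obtain \<theta> where \<theta>: "\<theta> \<in> [V]\<^bsup>2\<^esup> \<rightarrow>\<^sub>E \<Theta>"
      "\<And>\<tau> S. \<tau> \<in> T \<Longrightarrow> S \<in> [V]\<^bsup>h\<^esup> \<Longrightarrow> \<exists>e\<in>[S]\<^bsup>2\<^esup>. \<theta> e \<in> G \<tau> e" by blast
  show thesis
  proof (rule that[OF \<theta>(1)])
    fix \<tau> S assume "\<tau> \<in> T" "S \<subseteq> V" "h \<le> card S"
    moreover from this obtain S' where "S' \<subseteq> S" "card S' = h" "finite S'"
      by (metis obtain_subset_with_card_n)
    ultimately obtain e where "e \<in> [S']\<^bsup>2\<^esup>" "\<theta> e \<in> G \<tau> e"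
      using \<theta>(2)[of \<tau> S'] by (auto simp: nsets_def)
    then show "\<exists>e\<in>[S]\<^bsup>2\<^esup>. \<theta> e \<in> G \<tau> e" using nsets_mono[OF \<open>S' \<subseteq> S\<close>] by blast
  qed
qed


text \<open>Pigeonhole over the \<open>2 * card C\<close> combinations of side and colour. A fixed
  side is wanted because the colourings below treat the smallest and the largest vertex of a triple
  differently.\<close>

lemma one_sided_constant_subset:
  fixes v :: nat and \<phi> :: "nat set \<Rightarrow> 'c"
  assumes "finite S" "v \<notin> S" "finite C" "C \<noteq> {}" "\<And>x. x \<in> S \<Longrightarrow> \<phi> {v, x} \<in> C"
    "2 * card C * h \<le> card S"
  obtains S' c where "S' \<subseteq> S" "h \<le> card S'" "c \<in> C" "\<And>x. x \<in> S' \<Longrightarrow> \<phi> {v, x} = c"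
    "(\<forall>x\<in>S'. v < x) \<or> (\<forall>x\<in>S'. x < v)"
proof -
  let ?f = "\<lambda>x. (v < x, \<phi> {v, x})"
  obtain t where t: "t \<in> UNIV \<times> C" "card S \<le> card (UNIV \<times> C :: (bool \<times> 'c) set) * card {x \<in> S. ?f x = t}"
    using pigeonhole_card_vimage[of S "UNIV \<times> C" ?f] assms(1,3-5) by (auto simp: image_subset_iff)
  define S' where "S' = {x \<in> S. ?f x = t}"
  have "(2 * card C) * h \<le> (2 * card C) * card S'"
    using order_trans[OF assms(6) t(2)] by (simp only: card_cartesian_product card_UNIV_bool S'_def)
  then have "h \<le> card S'" using assms(3,4) by (simp add: card_gt_0_iff)
  moreover have "(\<forall>x\<in>S'. v < x) \<or> (\<forall>x\<in>S'. x < v)"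
    using assms(2) by (cases "fst t") (auto simp: S'_def not_less_iff_gr_or_eq)
  ultimately show thesis
    using t(1) by (intro that[of S' "snd t"]) (auto simp: S'_def)
qed

section \<open>Colourings defined on increasing triples\<close>

definition ordered_colouring :: "(nat \<Rightarrow> nat \<Rightarrow> nat \<Rightarrow> bool) \<Rightarrow> nat set \<Rightarrow> colour" where
  "ordered_colouring P e = (if \<exists>i j k. i < j \<and> j < k \<and> e = {i, j, k} \<and> P i j k then Red else Blue)"

text \<open>A triple has only one increasing enumeration, so a single instance of \<open>P\<close>
  decides its colour.\<close>

lemma ordered_colouring_eq_Red_iff:
  assumes "i < j" "j < k"
  shows "ordered_colouring P {i, j, k} = Red \<longleftrightarrow> P i j k"
proof -
  have "i' = i \<and> j' = j \<and> k' = k" if "i' < j'" "j' < k'" "{i, j, k} = {i', j', k'}" for i' j' k'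
  proof -
    have "i \<in> {i', j', k'}" "j \<in> {i', j', k'}" "k \<in> {i', j', k'}" using that(3) by blast+
    with assms that(1,2) show ?thesis by auto
  qed
  then show ?thesis using assms by (auto simp: ordered_colouring_def)
qed

text \<open>The graph colouring \<open>\<phi>\<close> shows both colours in every set of
  \<open>8 * e\<close> vertices. Fixing the side and the colour seen from a star centre costs a
  factor 4, hence \<open>32 * e\<close>.\<close>

lemma power_less_ramsey_number_clique_star:
  assumes "s \<ge> 5" "e \<ge> 1" "n \<ge> 32 * e"
  shows "2 ^ e < ramsey_number (complete3 s) (star3 n)"
proof -
  let ?V = "{..<2 ^ e :: nat}"
  obtain \<phi> where \<phi>: "\<And>c S. S \<subseteq> ?V \<Longrightarrow> 8 * e \<le> card S \<Longrightarrow> \<exists>d\<in>[S]\<^bsup>2\<^esup>. \<phi> d = (c :: bool)"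
  proof -
    have "ln (real (card (UNIV :: bool set))) + real (8 * e) * ln (real (card ?V))
        < real (8 * e) * (real (8 * e) - 1) / (2 * 2)"
    proof -
      have ln2: "ln 2 \<le> (1 :: real)" using ln_2_less_1 by simp
      have e1: "real e \<ge> 1" using assms(2) by simp
      have "ln (real (card (UNIV :: bool set))) + real (8 * e) * ln (real (card ?V)) =
          (1 + 8 * real e * real e) * ln 2"
        by (simp add: ln_realpow algebra_simps)
      also have "\<dots> \<le> 1 + 8 * real e * real e"
        using ln2 mult_left_mono[of "ln 2" 1 "1 + 8 * real e * real e"] by simp
      also have "\<dots> < 16 * real e * real e - 2 * real e"
      proof -
        have "real e \<le> real e * real e" using e1 mult_left_mono[of 1 "real e" "real e"] by simp
        then show ?thesis using e1 by linarith
      qed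
      finally show ?thesis by (simp add: algebra_simps)
    qed
    then show thesis
      using that
      by (rule_tac exists_labelling[of ?V "UNIV :: bool set" UNIV 2 "\<lambda>c _. {c}" "8 * e"])
         (auto simp: card_UNIV_bool lessThan_empty_iff)
  qed
  define \<chi> where "\<chi> = ordered_colouring (\<lambda>i j k. \<phi> {i, j} \<noteq> \<phi> {j, k})"
  have no_clique: "\<exists>e\<in>[K]\<^bsup>3\<^esup>. \<chi> e \<noteq> Red" if K: "K \<subseteq> ?V" "card K = s" for K
  proof (rule ccontr)
    assume "\<not> ?thesis"
    then have red: "\<chi> e = Red" if "e \<in> [K]\<^bsup>3\<^esup>" for e using that by blast
    obtain K' where "K' \<in> [K]\<^bsup>5\<^esup>"
      using nsets_eq_empty_iff[of K 5] K assms(1) by fastforce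
    then obtain a b c d f where *: "{a, b, c, d, f} \<subseteq> K" "a < b" "b < c" "c < d" "d < f"
      unfolding ordered_nsets_5_eq by blast
    have neq: "\<phi> {i, j} \<noteq> \<phi> {j, k}" if "i \<in> K" "j \<in> K" "k \<in> K" "i < j" "j < k" for i j k
    proof -
      have "{i, j, k} \<in> [K]\<^bsup>3\<^esup>" using that by (auto simp: nsets_def)
      from red[OF this] show ?thesis
        unfolding \<chi>_def ordered_colouring_eq_Red_iff[OF that(4,5)] .
    qed
    \<comment> \<open>The five inequalities run around the cycle of pairs ab, bc, cd, df, bd, and an
      odd cycle has no proper colouring with two colours.\<close>
    have "\<phi> {a, b} \<noteq> \<phi> {b, c}" "\<phi> {a, b} \<noteq> \<phi> {b, d}" "\<phi> {b, c} \<noteq> \<phi> {c, d}"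
        "\<phi> {c, d} \<noteq> \<phi> {d, f}" "\<phi> {b, d} \<noteq> \<phi> {d, f}"
      using * neq[of a b c] neq[of a b d] neq[of b c d] neq[of c d f] neq[of b d f] by simp_all
    then show False by blast
  qed
  have no_star: "\<exists>x\<in>S. \<exists>y\<in>S. x \<noteq> y \<and> \<chi> {v, x, y} \<noteq> Blue"
    if v: "v < 2 ^ e" and S: "S \<subseteq> ?V - {v}" "card S = n" for v S
  proof -
    have "2 * card (UNIV :: bool set) * (8 * e) \<le> card S"
      using S(2) assms(3) by (simp add: card_UNIV_bool)
    then obtain S' c where S': "S' \<subseteq> S" "8 * e \<le> card S'" "\<And>x. x \<in> S' \<Longrightarrow> \<phi> {v, x} = c"
        "(\<forall>x\<in>S'. v < x) \<or> (\<forall>x\<in>S'. x < v)"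
      using one_sided_constant_subset[of S v "UNIV :: bool set" \<phi> "8 * e"] S(1) finite_subset[OF S(1)]
      by auto
    \<comment> \<open>With a pair of colour other than \<open>c\<close>, the middle vertex of the
      triple sees both colours, whether \<open>v\<close> comes first or last.\<close>
    obtain d where "d \<in> [S']\<^bsup>2\<^esup>" "\<phi> d = (\<not> c)" using \<phi>[of S' "\<not> c"] S' S(1) by blast
    then obtain x y where xy: "x \<in> S'" "y \<in> S'" "x < y" "\<phi> {x, y} = (\<not> c)"
      unfolding ordered_nsets_2_eq by blast
    from S'(4) have "\<chi> {v, x, y} = Red"
    proof
      assume "\<forall>x\<in>S'. v < x"
      then show ?thesis using xy S'(3) by (simp add: \<chi>_def ordered_colouring_eq_Red_iff)
    next
      assume "\<forall>x\<in>S'. x < v"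
      moreover have "\<phi> {y, v} = c" using S'(3)[of y] xy(2) by (simp add: insert_commute)
      ultimately have "ordered_colouring (\<lambda>i j k. \<phi> {i, j} \<noteq> \<phi> {j, k}) {x, y, v} = Red"
        using xy by (simp add: ordered_colouring_eq_Red_iff)
      moreover have "{x, y, v} = {v, x, y}" by blast
      ultimately show ?thesis by (simp add: \<chi>_def)
    qed
    with xy S'(1) show ?thesis by (intro bexI[of _ x] bexI[of _ y]) auto
  qed
  have "\<not> ramsey_prop (complete3 s) (star3 n) (2 ^ e)"
    unfolding ramsey_prop_iff using no_clique no_star by (intro notI) (metis (no_types, lifting))
  then show ?thesis by (rule less_ramsey_number)
qed

section \<open>The lower bound for four vertices\<close>

text \<open>Greedy Gilbert-Varshamov argument: words agreeing with a given codeword on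
  \<open>Suc D\<close> fixed positions number \<open>q ^ (d - Suc D)\<close>, and there are at most
  \<open>2 ^ d\<close> position sets. Hence \<open>M\<close> codewords exclude fewer than
  \<open>q ^ d\<close> words as long as \<open>Suc M * 2 ^ d \<le> q ^ Suc D\<close>.\<close>

lemma exists_code:
  fixes q d D :: nat
  assumes "D < d" "M * 2 ^ d \<le> q ^ Suc D"
  shows "\<exists>A\<subseteq>{..<d} \<rightarrow>\<^sub>E {..<q}. card A = M \<and>
    (\<forall>f\<in>A. \<forall>g\<in>A. f \<noteq> g \<longrightarrow> card {p. p < d \<and> f p = g p} \<le> D)"
  using assms(2)
proof (induction M)
  case 0
  then show ?case by (intro exI[of _ "{}"]) auto
next
  case (Suc M)
  then obtain A where A: "A \<subseteq> {..<d} \<rightarrow>\<^sub>E {..<q}" "card A = M"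
      and agree: "\<forall>f\<in>A. \<forall>g\<in>A. f \<noteq> g \<longrightarrow> card {p. p < d \<and> f p = g p} \<le> D"
    by auto
  have q: "q > 0" using Suc.prems by (cases q) auto
  have finA: "finite A" using A(1) by (rule finite_subset) (simp add: finite_PiE)
  define near where "near f X = (\<Pi>\<^sub>E p\<in>{..<d}. if p \<in> X then {f p} else {..<q})" for f :: "nat \<Rightarrow> nat" and X
  have card_near: "card (near f X) = q ^ (d - Suc D)" if "X \<in> [{..<d}]\<^bsup>Suc D\<^esup>" for f X
  proof -
    from that have X: "X \<subseteq> {..<d}" "card X = Suc D" by (auto simp: nsets_def)
    have "card (near f X) = (\<Prod>p<d. if p \<in> X then 1 else q)"
      by (auto simp: near_def card_PiE intro!: prod.cong)
    also have "\<dots> = (\<Prod>p\<in>{..<d} - X. q)"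
      using X(1) by (intro prod.mono_neutral_cong_right) auto
    also have "\<dots> = q ^ (d - Suc D)" using X finite_subset[OF X(1)] by (simp add: card_Diff_subset)
    finally show ?thesis .
  qed
  have "card (\<Union>f\<in>A. \<Union>X\<in>[{..<d}]\<^bsup>Suc D\<^esup>. near f X) \<le> (\<Sum>f\<in>A. \<Sum>X\<in>[{..<d}]\<^bsup>Suc D\<^esup>. card (near f X))"
    by (rule order_trans[OF card_UN_le[OF finA] sum_mono]) (simp add: card_UN_le finite_imp_finite_nsets)
  also have "\<dots> = M * (d choose Suc D) * q ^ (d - Suc D)" by (simp add: card_near A(2))
  also have "\<dots> \<le> M * 2 ^ d * q ^ (d - Suc D)"
    by (intro mult_le_mono binomial_le_pow2 order_refl)
  also have "\<dots> < Suc M * 2 ^ d * q ^ (d - Suc D)" using q by simp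
  also have "\<dots> \<le> q ^ Suc D * q ^ (d - Suc D)" using Suc.prems by (rule mult_le_mono1)
  also have "\<dots> = q ^ d" using assms(1) by (metis Suc_leI le_add_diff_inverse power_add)
  also have "\<dots> = card ({..<d} \<rightarrow>\<^sub>E {..<q})" by (simp add: card_PiE)
  finally have "\<not> {..<d} \<rightarrow>\<^sub>E {..<q} \<subseteq> (\<Union>f\<in>A. \<Union>X\<in>[{..<d}]\<^bsup>Suc D\<^esup>. near f X)"
    using card_mono[of "\<Union>f\<in>A. \<Union>X\<in>[{..<d}]\<^bsup>Suc D\<^esup>. near f X" "{..<d} \<rightarrow>\<^sub>E {..<q}"] finA
    by (auto simp: near_def finite_PiE finite_imp_finite_nsets)
  then obtain g where g: "g \<in> {..<d} \<rightarrow>\<^sub>E {..<q}"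
      and far: "\<And>f X. f \<in> A \<Longrightarrow> X \<in> [{..<d}]\<^bsup>Suc D\<^esup> \<Longrightarrow> g \<notin> near f X" by blast
  have g_agree: "card {p. p < d \<and> f p = g p} \<le> D" if "f \<in> A" for f
  proof (rule ccontr)
    assume "\<not> ?thesis"
    then have "Suc D \<le> card {p. p < d \<and> f p = g p}" by simp
    then obtain X where X: "X \<subseteq> {p. p < d \<and> f p = g p}" "card X = Suc D" "finite X"
      by (rule obtain_subset_with_card_n)
    then have "X \<in> [{..<d}]\<^bsup>Suc D\<^esup>" by (auto simp: nsets_def)
    moreover have "g \<in> near f X"
      unfolding near_def
    proof (rule PiE_I)
      fix p assume p: "p \<in> {..<d}"
      show "g p \<in> (if p \<in> X then {f p} else {..<q})"
      proof (cases "p \<in> X")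
        case True
        from subsetD[OF X(1) this] have "g p = f p" by simp
        with True show ?thesis by simp
      next
        case False
        then show ?thesis using PiE_mem[OF g p] by simp
      qed
    next
      fix p assume "p \<notin> {..<d}"
      with g show "g p = undefined" by (rule PiE_arb)
    qed
    ultimately show False using far[OF that] by blast
  qed
  \<comment> \<open>A member of \<open>A\<close> equal to \<open>g\<close> would agree with it in
    all \<open>d\<close> positions, and \<open>d\<close> exceeds \<open>D\<close>.\<close>
  have "g \<notin> A" using g_agree[of g] assms(1) by auto
  then have "card (insert g A) = Suc M" using A(2) finA by simp
  moreover have "card {p. p < d \<and> f p = f' p} \<le> D"
    if "f \<in> insert g A" "f' \<in> insert g A" "f \<noteq> f'" for f f'
  proof -
    consider "f = g" "f' \<in> A" | "f' = g" "f \<in> A" | "f \<in> A" "f' \<in> A"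
      using \<open>f \<in> insert g A\<close> \<open>f' \<in> insert g A\<close> \<open>f \<noteq> f'\<close> by blast
    then show ?thesis
    proof cases
      case 1
      have "{p. p < d \<and> g p = f' p} = {p. p < d \<and> f' p = g p}" by (intro Collect_cong) metis
      then show ?thesis using g_agree[OF 1(2)] 1(1) by simp
    next
      case 2
      then show ?thesis using g_agree by simp
    next
      case 3
      then show ?thesis using agree \<open>f \<noteq> f'\<close> by blast
    qed
  qed
  ultimately show ?case
    using A(1) g by (intro exI[of _ "insert g A"]) blast
qed

lemma ex_bit_neq_of_less_power:
  fixes v w :: nat
  assumes "v < 2 ^ d" "w < 2 ^ d" "v \<noteq> w"
  shows "\<exists>p<d. bit v p \<noteq> bit w p"
proof -
  obtain p where p: "bit v p \<noteq> bit w p" using assms(3) by (meson bit_eqI)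
  have "p < d"
  proof (rule ccontr)
    assume "\<not> p < d"
    then have "(2 :: nat) ^ d \<le> 2 ^ p" by simp
    then have "v < 2 ^ p" "w < 2 ^ p" using assms by linarith+
    then show False using p by (simp add: bit_iff_odd)
  qed
  with p show ?thesis by blast
qed

lemma card_subsets_with_prescribed_trace:
  assumes "finite U" "A \<subseteq> U"
  shows "2 ^ (card U - card A) \<le> card {X. X \<subseteq> U \<and> (\<forall>p\<in>A. p \<in> X \<longleftrightarrow> Q p)}"
proof -
  let ?g = "\<lambda>Y. Y \<union> {p \<in> A. Q p}"
  have "inj_on ?g (Pow (U - A))" by (rule inj_onI) blast
  moreover have "?g ` Pow (U - A) \<subseteq> {X. X \<subseteq> U \<and> (\<forall>p\<in>A. p \<in> X \<longleftrightarrow> Q p)}"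
    using assms(2) by auto
  ultimately have "card (Pow (U - A)) \<le> card {X. X \<subseteq> U \<and> (\<forall>p\<in>A. p \<in> X \<longleftrightarrow> Q p)}"
    using assms(1) by (intro card_inj_on_le) auto
  then show ?thesis
    using assms by (simp add: card_Pow card_Diff_subset finite_subset)
qed

text \<open>Of the 16 ways to realise the four triples of a 4-set, all but one force a fixed point or a
  2-cycle of \<open>s\<close>.\<close>

lemma rectangle_of_clique_aux:
  fixes s :: "'a \<Rightarrow> 'a"
  assumes "\<And>x. x \<in> {ij, ik, jk, il, jl, kl} \<Longrightarrow> s x \<noteq> x \<and> s (s x) \<noteq> x"
    and "(ij = ik \<and> jk = s ij) \<and> C1 \<or> (ik = jk \<and> ij = s jk) \<and> R1"
    and "(ij = il \<and> jl = s ij) \<and> C2 \<or> (il = jl \<and> ij = s jl) \<and> R2"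
    and "(ik = il \<and> kl = s ik) \<and> C3 \<or> (il = kl \<and> ik = s kl) \<and> R3"
    and "(jk = jl \<and> kl = s jk) \<and> C4 \<or> (jl = kl \<and> jk = s kl) \<and> R4"
  shows "R1 \<and> R2 \<and> C3 \<and> C4"
  using assms(2-5) assms(1)[of ij] assms(1)[of ik] assms(1)[of jk] assms(1)[of il] assms(1)[of jl]
    assms(1)[of kl]
  by (elim disjE conjE; hypsubst?; simp)

text \<open>The shift \<open>x + 1\<close> modulo 3 has neither fixed points nor 2-cycles. In each
  triple, \<open>C\<close> stands for the condition with the first vertex as apex over the other two
  and \<open>R\<close> for that with the last; what survives is \<open>k\<close> and
  \<open>l\<close> over \<open>ij\<close>, and \<open>i\<close> and \<open>j\<close> over
  \<open>kl\<close>.\<close>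

lemma rectangle_of_clique:
  fixes \<phi> :: "nat set \<Rightarrow> nat"
  assumes "\<And>e. e \<in> {{i, j}, {i, k}, {j, k}, {i, l}, {j, l}, {k, l}} \<Longrightarrow> \<phi> e < 3"
    and "(\<phi> {i, j} = \<phi> {i, k} \<and> \<phi> {j, k} = (\<phi> {i, j} + 1) mod 3) \<and> C1 \<or>
         (\<phi> {i, k} = \<phi> {j, k} \<and> \<phi> {i, j} = (\<phi> {j, k} + 1) mod 3) \<and> R1"
    and "(\<phi> {i, j} = \<phi> {i, l} \<and> \<phi> {j, l} = (\<phi> {i, j} + 1) mod 3) \<and> C2 \<or>
         (\<phi> {i, l} = \<phi> {j, l} \<and> \<phi> {i, j} = (\<phi> {j, l} + 1) mod 3) \<and> R2"
    and "(\<phi> {i, k} = \<phi> {i, l} \<and> \<phi> {k, l} = (\<phi> {i, k} + 1) mod 3) \<and> C3 \<or>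
         (\<phi> {i, l} = \<phi> {k, l} \<and> \<phi> {i, k} = (\<phi> {k, l} + 1) mod 3) \<and> R3"
    and "(\<phi> {j, k} = \<phi> {j, l} \<and> \<phi> {k, l} = (\<phi> {j, k} + 1) mod 3) \<and> C4 \<or>
         (\<phi> {j, l} = \<phi> {k, l} \<and> \<phi> {j, k} = (\<phi> {k, l} + 1) mod 3) \<and> R4"
  shows "R1 \<and> R2 \<and> C3 \<and> C4"
proof (rule rectangle_of_clique_aux[where s = "\<lambda>x. (x + 1) mod 3", OF _ assms(2-5)])
  fix x assume "x \<in> {\<phi> {i, j}, \<phi> {i, k}, \<phi> {j, k}, \<phi> {i, l}, \<phi> {j, l}, \<phi> {k, l}}"
  then have "x < 3" using assms(1) by blast
  then have "x = 0 \<or> x = 1 \<or> x = 2" by linarith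
  then show "(x + 1) mod 3 \<noteq> x \<and> ((x + 1) mod 3 + 1) mod 3 \<noteq> x" by auto
qed

text \<open>The constant 24 makes \<open>(h - 1) / (6 * 4 ^ D)\<close> equal to
  \<open>4 * D\<^sup>2\<close>, so the right side is \<open>4 * h * D\<^sup>2\<close>. The number
  \<open>6 * 2 ^ D\<^sup>2\<close> counts the events, given by vertex, residue and side.\<close>

lemma ln_bound_for_labelling:
  fixes D h :: nat
  assumes "D \<ge> 1" "h = 24 * 4 ^ D * D\<^sup>2 + 1"
  shows "ln (6 * 2 ^ D\<^sup>2) + real h * ln (2 ^ D\<^sup>2) < real h * (real h - 1) / (2 * (3 * 4 ^ D))"
proof -
  have D: "1 \<le> real (D\<^sup>2)" using assms(1) by (simp add: Suc_le_eq)
  have h: "25 \<le> real h"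
  proof -
    have "1 \<le> 4 ^ D * D\<^sup>2" using assms(1) by (simp add: Suc_le_eq)
    then have "25 \<le> h" unfolding assms(2) by linarith
    then show ?thesis by simp
  qed
  have ln2: "real (D\<^sup>2) * ln 2 \<le> real (D\<^sup>2)" using ln_2_less_1 by (intro mult_left_le) auto
  have "ln (6 * 2 ^ D\<^sup>2) + real h * ln (2 ^ D\<^sup>2) = ln 6 + (1 + real h) * (real (D\<^sup>2) * ln 2)"
    by (simp add: ln_mult ln_realpow algebra_simps)
  also have "\<dots> \<le> 5 + (1 + real h) * real (D\<^sup>2)"
    using ln2 ln_le_minus_one[of 6] by (intro add_mono mult_left_mono) auto
  also have "\<dots> < 4 * (real h * real (D\<^sup>2))"
  proof -
    have "real h \<le> real h * real (D\<^sup>2)" using D h mult_left_mono[of 1 "real (D\<^sup>2)" "real h"] by simp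
    moreover have "real (D\<^sup>2) \<le> real h * real (D\<^sup>2)" using D h mult_right_mono[of 1 "real h" "real (D\<^sup>2)"] by simp
    ultimately show ?thesis using h unfolding distrib_right by linarith
  qed
  also have "\<dots> = real h * (real h - 1) / (2 * (3 * 4 ^ D))"
    unfolding assms(2) by (simp add: field_simps)
  finally show ?thesis .
qed

lemma power_square_less_ramsey_number_K4_star:
  assumes D: "D \<ge> 2" and n: "n \<ge> 6 * (24 * 4 ^ D * D\<^sup>2 + 1)"
  shows "2 ^ D\<^sup>2 < ramsey_number (complete3 4) (star3 n)"
proof -
  define d where "d = D\<^sup>2"
  define q :: nat where "q = 4 ^ D"
  define h where "h = 24 * 4 ^ D * D\<^sup>2 + 1"
  let ?V = "{..<2 ^ d :: nat}"
  have Dd: "D < d" using D unfolding d_def power2_eq_square by (cases D) auto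
  \<comment> \<open>Alphabet size \<open>4 ^ D\<close> gives \<open>q ^ D = 2 ^ d * 2 ^ d\<close>,
    which is room for one codeword per vertex.\<close>
  have "2 ^ d * 2 ^ d \<le> q ^ Suc D"
  proof -
    have "2 ^ d * 2 ^ d = ((4 :: nat) ^ D) ^ D"
      by (simp add: d_def power2_eq_square flip: power_mult power_mult_distrib)
    also have "\<dots> \<le> q ^ Suc D" unfolding q_def by (intro power_increasing) auto
    finally show ?thesis by simp
  qed
  from exists_code[OF Dd this] obtain A where A: "A \<subseteq> {..<d} \<rightarrow>\<^sub>E {..<q}" "card A = 2 ^ d"
    and agree_A: "\<And>f g. f \<in> A \<Longrightarrow> g \<in> A \<Longrightarrow> f \<noteq> g \<Longrightarrow> card {p. p < d \<and> f p = g p} \<le> D" by blast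
  have "finite A" using A(1) by (rule finite_subset) (simp add: finite_PiE)
  then obtain f where f: "bij_betw f ?V A"
    using finite_same_card_bij[of ?V A] A(2) by auto
  have f_less: "f v p < q" if "v < 2 ^ d" "p < d" for v p
    using bij_betw_apply[OF f, of v] A(1) that by (auto simp: PiE_iff)
  have agree: "card {p. p < d \<and> f v p = f w p} \<le> D" if "v < 2 ^ d" "w < 2 ^ d" "v \<noteq> w" for v w
    using that bij_betw_apply[OF f] bij_betw_imp_inj_on[OF f]
    by (intro agree_A) (auto simp: inj_on_eq_iff)
  define \<pi> where "\<pi> e = (LEAST p. bit (Min e) p \<noteq> bit (Max e) p)" for e :: "nat set"
  have \<pi>: "\<pi> {v, w} < d \<and> bit v (\<pi> {v, w}) \<noteq> bit w (\<pi> {v, w})" if "v < w" "w < 2 ^ d" for v w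
  proof -
    obtain p where p: "p < d" "bit v p \<noteq> bit w p"
      using ex_bit_neq_of_less_power[of v d w] \<open>v < w\<close> \<open>w < 2 ^ d\<close> by auto
    have "\<pi> {v, w} = (LEAST p. bit v p \<noteq> bit w p)" using that by (simp add: \<pi>_def)
    then show ?thesis
      using p LeastI[of "\<lambda>p. bit v p \<noteq> bit w p" p] Least_le[of "\<lambda>p. bit v p \<noteq> bit w p" p] by simp
  qed
  define \<Theta> :: "(nat \<times> nat \<times> nat set) set" where "\<Theta> = {..<3} \<times> {..<q} \<times> Pow {..<d}"
  define E where "E e v = {\<epsilon>. \<epsilon> \<subseteq> {..<d} \<and>
    (\<forall>p\<in>{p. p < d \<and> f (Min e) p = f (Max e) p}. p \<in> \<epsilon> \<longleftrightarrow> bit v p)}" for e :: "nat set" and v :: nat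
  \<comment> \<open>Event \<open>(v, c, right)\<close>: when both pairs joining \<open>v\<close> to
    \<open>e\<close> carry the residue \<open>c\<close>, a label in \<open>G\<close> makes the
    triple red, through the letter if \<open>e\<close> lies above \<open>v\<close> and through the
    bits if it lies below.\<close>
  define G :: "nat \<times> nat \<times> bool \<Rightarrow> nat set \<Rightarrow> (nat \<times> nat \<times> nat set) set" where
    "G = (\<lambda>(v, c, right) e. {(c + 1) mod 3} \<times>
      (if right then {f v (\<pi> e)} \<times> Pow {..<d} else {..<q} \<times> E e v))"
  have G: "G \<tau> e \<subseteq> \<Theta> \<and> real (card \<Theta>) \<le> 3 * 4 ^ D * real (card (G \<tau> e))"
    if \<tau>: "\<tau> \<in> ?V \<times> {..<3} \<times> UNIV" and e: "e \<in> [?V]\<^bsup>2\<^esup>" for \<tau> e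
  proof -
    obtain x y where xy: "e = {x, y}" "x < y" "x < 2 ^ d" "y < 2 ^ d"
      using e unfolding ordered_nsets_2_eq by auto
    obtain v c right where \<tau>_eq: "\<tau> = (v, c, right)" "v < 2 ^ d" using \<tau> by (cases \<tau>) auto
    \<comment> \<open>The residue has probability 1/3 and a letter \<open>1 / q\<close>. At most
      \<open>D\<close> bits are prescribed, so the bits have probability at least
      \<open>1 / 2 ^ D\<close>, weakened to \<open>1 / 4 ^ D\<close> so that one \<open>K\<close>
      serves both kinds of event.\<close>
    have le: "card \<Theta> \<le> 3 * 4 ^ D * card (G \<tau> e)"
    proof (cases right)
      case True
      then show ?thesis
        by (simp add: \<tau>_eq G_def \<Theta>_def card_cartesian_product card_Pow q_def)
    next
      case False
      have "(2 :: nat) ^ d = 2 ^ D * 2 ^ (d - D)" using Dd by (simp flip: power_add)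
      also have "\<dots> \<le> 4 ^ D * card (E e v)"
      proof (rule mult_le_mono)
        have "(2 :: nat) ^ (d - D) \<le> 2 ^ (card {..<d} - card {p. p < d \<and> f x p = f y p})"
          using agree[of x y] xy by (intro power_increasing) auto
        also have "\<dots> \<le> card (E e v)"
          unfolding E_def using xy
          by (intro order_trans[OF card_subsets_with_prescribed_trace[of "{..<d}" _ "bit v"]]) auto
        finally show "(2 :: nat) ^ (d - D) \<le> card (E e v)" .
      qed (simp add: power_mono)
      finally show ?thesis using False
        by (simp add: \<tau>_eq G_def \<Theta>_def card_cartesian_product card_Pow)
    qed
    have "G \<tau> e \<subseteq> \<Theta>"
      using f_less[OF \<tau>_eq(2)] \<pi>[OF xy(2,4)] xy(1)
      by (auto simp: \<tau>_eq G_def \<Theta>_def E_def)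
    moreover have "real (card \<Theta>) \<le> real (3 * 4 ^ D * card (G \<tau> e))"
      using le by (rule of_nat_mono)
    ultimately show ?thesis by simp
  qed
  have ln_bound: "ln (real (card (?V \<times> {..<3 :: nat} \<times> (UNIV :: bool set)))) + real h * ln (real (card ?V))
      < real h * (real h - 1) / (2 * (3 * 4 ^ D))"
    using ln_bound_for_labelling[of D h] D
    by (simp add: h_def card_cartesian_product card_UNIV_bool mult.commute flip: d_def)
  obtain \<theta> where \<theta>: "\<theta> \<in> [?V]\<^bsup>2\<^esup> \<rightarrow>\<^sub>E \<Theta>"
      and hit: "\<And>\<tau> S. \<tau> \<in> ?V \<times> {..<3} \<times> UNIV \<Longrightarrow> S \<subseteq> ?V \<Longrightarrow> h \<le> card S \<Longrightarrow> \<exists>e\<in>[S]\<^bsup>2\<^esup>. \<theta> e \<in> G \<tau> e"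
  proof (rule exists_labelling[OF _ _ _ _ _ _ _ G ln_bound])
    show "?V \<noteq> {}" "?V \<times> {..<3 :: nat} \<times> (UNIV :: bool set) \<noteq> {}" "\<Theta> \<noteq> {}"
      by (auto simp: lessThan_empty_iff \<Theta>_def q_def)
    show "1 \<le> 3 * (4 :: real) ^ D" using one_le_power[of "4 :: real" D] by linarith
  qed (auto simp: \<Theta>_def)
  define \<phi> where "\<phi> e = fst (\<theta> e)" for e
  define t where "t e = fst (snd (\<theta> e))" for e
  define \<epsilon> where "\<epsilon> e = snd (snd (\<theta> e))" for e
  have \<phi>_less: "\<phi> {v, w} < 3" if "v < 2 ^ d" "w < 2 ^ d" "v \<noteq> w" for v w
    using PiE_mem[OF \<theta>, of "{v, w}"] that by (auto simp: \<phi>_def \<Theta>_def)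
  define P where "P i j k \<longleftrightarrow>
      (\<phi> {i, j} = \<phi> {i, k} \<and> \<phi> {j, k} = (\<phi> {i, j} + 1) mod 3) \<and> t {j, k} = f i (\<pi> {j, k}) \<or>
      (\<phi> {i, k} = \<phi> {j, k} \<and> \<phi> {i, j} = (\<phi> {j, k} + 1) mod 3) \<and>
        (\<forall>p<d. f i p = f j p \<longrightarrow> (p \<in> \<epsilon> {i, j} \<longleftrightarrow> bit k p))" for i j k
  define \<chi> where "\<chi> = ordered_colouring P"
  have no_clique: "\<exists>e\<in>[K]\<^bsup>3\<^esup>. \<chi> e \<noteq> Red" if K: "K \<subseteq> ?V" "card K = 4" for K
  proof (rule ccontr)
    assume "\<not> ?thesis"
    then have red: "\<chi> e = Red" if "e \<in> [K]\<^bsup>3\<^esup>" for e using that by blast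
    have "K \<in> [K]\<^bsup>4\<^esup>" using K finite_subset[OF K(1)] by (simp add: nsets_def)
    then obtain i j k l where ijkl: "{i, j, k, l} \<subseteq> K" "i < j" "j < k" "k < l"
      unfolding ordered_nsets_4_eq by blast
    have P: "P i j k" if "i \<in> K" "j \<in> K" "k \<in> K" "i < j" "j < k" for i j k
    proof -
      have "{i, j, k} \<in> [K]\<^bsup>3\<^esup>" using that by (auto simp: nsets_def)
      from red[OF this] show ?thesis
        unfolding \<chi>_def ordered_colouring_eq_Red_iff[OF that(4,5)] .
    qed
    have less: "i < 2 ^ d" "j < 2 ^ d" "k < 2 ^ d" "l < 2 ^ d" using ijkl K(1) by auto
    have "P i j k" "P i j l" "P i k l" "P j k l" using ijkl P by auto
    note Ps = this[unfolded P_def]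
    have "\<phi> e < 3" if "e \<in> {{i, j}, {i, k}, {j, k}, {i, l}, {j, l}, {k, l}}" for e
      using that less ijkl(2-4) by (auto intro!: \<phi>_less)
    from rectangle_of_clique[OF this Ps]
    have R: "\<forall>p<d. f i p = f j p \<longrightarrow> (p \<in> \<epsilon> {i, j} \<longleftrightarrow> bit k p)"
        "\<forall>p<d. f i p = f j p \<longrightarrow> (p \<in> \<epsilon> {i, j} \<longleftrightarrow> bit l p)"
        "t {k, l} = f i (\<pi> {k, l})" "t {k, l} = f j (\<pi> {k, l})" by blast+
    \<comment> \<open>The last two facts make \<open>f i\<close> and \<open>f j\<close> agree at
      \<open>\<pi> {k, l}\<close>; the first two then force equal digits of \<open>k\<close> and
      \<open>l\<close> at a position where they differ.\<close>
    show False using R \<pi>[OF ijkl(4) less(4)] by auto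
  qed
  have no_star: "\<exists>x\<in>S. \<exists>y\<in>S. x \<noteq> y \<and> \<chi> {v, x, y} \<noteq> Blue"
    if v: "v < 2 ^ d" and S: "S \<subseteq> ?V - {v}" "card S = n" for v S
  proof -
    have "2 * card {..<3 :: nat} * h \<le> card S" using S(2) n by (simp add: h_def)
    then obtain S' c where S': "S' \<subseteq> S" "h \<le> card S'" "c \<in> {..<3}"
        "\<And>x. x \<in> S' \<Longrightarrow> \<phi> {v, x} = c" "(\<forall>x\<in>S'. v < x) \<or> (\<forall>x\<in>S'. x < v)"
      using one_sided_constant_subset[of S v "{..<3}" \<phi> h] S(1) finite_subset[OF S(1)] v
      by (auto simp: lessThan_empty_iff intro!: \<phi>_less)
    have hit': "\<exists>x\<in>S'. \<exists>y\<in>S'. x < y \<and> \<theta> {x, y} \<in> G (v, c, right) {x, y}" for right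
    proof -
      have "(v, c, right) \<in> ?V \<times> {..<3} \<times> UNIV" using v S'(3) by simp
      then obtain e where "e \<in> [S']\<^bsup>2\<^esup>" "\<theta> e \<in> G (v, c, right) e"
        using hit[of "(v, c, right)" S'] S' S(1) by blast
      then show ?thesis unfolding ordered_nsets_2_eq by blast
    qed
    from S'(5) have "\<exists>x\<in>S'. \<exists>y\<in>S'. x < y \<and> \<chi> {v, x, y} = Red"
    proof
      assume right: "\<forall>x\<in>S'. v < x"
      obtain x y where xy: "x \<in> S'" "y \<in> S'" "x < y" "\<theta> {x, y} \<in> G (v, c, True) {x, y}"
        using hit' by blast
      then have "P v x y" using S'(4) by (auto simp: P_def G_def \<phi>_def t_def)
      then show ?thesis
        using xy right ordered_colouring_eq_Red_iff[of v x y P] unfolding \<chi>_def by blast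
    next
      assume left: "\<forall>x\<in>S'. x < v"
      obtain x y where xy: "x \<in> S'" "y \<in> S'" "x < y" "\<theta> {x, y} \<in> G (v, c, False) {x, y}"
        using hit' by blast
      have "\<phi> {x, v} = c" "\<phi> {y, v} = c"
        using S'(4)[OF xy(1)] S'(4)[OF xy(2)] by (simp_all add: insert_commute)
      then have "P x y v"
        using xy(3,4) by (auto simp: P_def G_def E_def \<phi>_def \<epsilon>_def)
      then have "\<chi> {x, y, v} = Red"
        using xy left ordered_colouring_eq_Red_iff[of x y v P] unfolding \<chi>_def by blast
      moreover have "{x, y, v} = {v, x, y}" by blast
      ultimately have "\<chi> {v, x, y} = Red" by simp
      with xy show ?thesis by blast
    qed
    then obtain x y where "x \<in> S" "y \<in> S" "x < y" "\<chi> {v, x, y} = Red" using S'(1) by blast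
    then show ?thesis by (intro bexI[of _ x] bexI[of _ y]) auto
  qed
  have "\<not> ramsey_prop (complete3 4) (star3 n) (2 ^ d)"
    unfolding ramsey_prop_iff using no_clique no_star by (intro notI) (metis (no_types, lifting))
  then show ?thesis unfolding d_def by (rule less_ramsey_number)
qed

section \<open>Independent sets in sparse graphs\<close>

text \<open>Without an independent \<open>n\<close>-set, a maximum independent set has fewer than
  \<open>n\<close> vertices, and together with their neighbours these cover \<open>V\<close>. So one
  of them has at least \<open>n ^ s\<close> neighbours, and the induction continues there.\<close>

lemma clique_or_indep_of_power_le:
  fixes E :: "'a set set"
  assumes "finite V" "n ^ s \<le> card V" "n > 0"
  shows "(\<exists>K\<subseteq>V. card K = s \<and> clique K E) \<or> (\<exists>S\<subseteq>V. card S = n \<and> indep S E)"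
  using assms(1,2)
proof (induction s arbitrary: V)
  case 0
  then show ?case by (intro disjI1 exI[of _ "{}"]) auto
next
  case (Suc s)
  show ?case
  proof (rule ccontr)
    assume contr: "\<not> ?thesis"
    have small: "card S < n" if "S \<subseteq> V" "indep S E" for S
    proof (rule ccontr)
      assume "\<not> ?thesis"
      then obtain S' where "S' \<subseteq> S" "card S' = n" by (metis not_less obtain_subset_with_card_n)
      moreover from this have "indep S' E" "S' \<subseteq> V" using that smaller_indep by blast+
      ultimately show False using contr by blast
    qed
    obtain J where J: "J \<subseteq> V" "indep J E" and max: "\<And>S. S \<subseteq> V \<Longrightarrow> indep S E \<Longrightarrow> card S \<le> card J"
    proof -
      let ?F = "{S. S \<subseteq> V \<and> indep S E}"
      have "finite ?F" using Suc.prems(1) by simp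
      moreover have "{} \<in> ?F" by simp
      ultimately have F: "finite (card ` ?F)" "card ` ?F \<noteq> {}" by blast+
      from Max_in[OF F] obtain J where J: "J \<in> ?F" "Max (card ` ?F) = card J" by (rule imageE)
      have "card S \<le> card J" if "S \<subseteq> V" "indep S E" for S
        using Max_ge[OF F(1), of "card S"] that by (simp add: J(2))
      with J(1) show thesis using that by blast
    qed
    have finJ: "finite J" using J(1) Suc.prems(1) by (rule finite_subset)
    define \<Gamma> where "\<Gamma> v = {w \<in> V. w \<noteq> v \<and> {v, w} \<in> E}" for v
    have "V \<subseteq> (\<Union>v\<in>J. insert v (\<Gamma> v))"
    proof
      fix w assume w: "w \<in> V"
      show "w \<in> (\<Union>v\<in>J. insert v (\<Gamma> v))"
      proof (rule ccontr)
        assume *: "w \<notin> (\<Union>v\<in>J. insert v (\<Gamma> v))"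
        then have "indep (insert w J) E"
          using J(2) w by (auto simp: indep_def \<Gamma>_def insert_commute)
        moreover have "w \<notin> J" using * by blast
        ultimately show False using max[of "insert w J"] J(1) w finJ by simp
      qed
    qed
    then have "card V \<le> (\<Sum>v\<in>J. card (insert v (\<Gamma> v)))"
      using finJ Suc.prems(1)
      by (intro order_trans[OF card_mono card_UN_le]) (auto simp: \<Gamma>_def)
    also have "\<dots> = (\<Sum>v\<in>J. Suc (card (\<Gamma> v)))"
      using Suc.prems(1) by (intro sum.cong refl) (simp add: \<Gamma>_def)
    finally have sum: "n ^ Suc s \<le> (\<Sum>v\<in>J. Suc (card (\<Gamma> v)))" using Suc.prems(2) by simp
    have "\<exists>v\<in>J. n ^ s \<le> card (\<Gamma> v)"
    proof (rule ccontr)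
      assume "\<not> ?thesis"
      then have "(\<Sum>v\<in>J. Suc (card (\<Gamma> v))) \<le> (\<Sum>v\<in>J. n ^ s)"
        by (intro sum_mono) (auto simp: not_le Suc_le_eq)
      also have "\<dots> < n ^ Suc s" using small[OF J] assms(3) by simp
      finally show False using sum by simp
    qed
    then obtain v where v: "v \<in> J" "n ^ s \<le> card (\<Gamma> v)" by blast
    have sub: "\<Gamma> v \<subseteq> V" "finite (\<Gamma> v)" using Suc.prems(1) by (auto simp: \<Gamma>_def)
    from Suc.IH[OF sub(2) v(2)] show False
    proof
      assume "\<exists>S\<subseteq>\<Gamma> v. card S = n \<and> indep S E"
      then show False using contr sub(1) by blast
    next
      assume "\<exists>K\<subseteq>\<Gamma> v. card K = s \<and> clique K E"
      then obtain K where K: "K \<subseteq> \<Gamma> v" "card K = s" "clique K E" by blast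
      then have "clique (insert v K) E" "v \<notin> K"
        by (auto simp: clique_def \<Gamma>_def insert_commute)
      moreover have "finite K" using K(1) sub(2) by (rule finite_subset)
      ultimately have "insert v K \<subseteq> V \<and> card (insert v K) = Suc s \<and> clique (insert v K) E"
        using K sub(1) J(1) v(1) by auto
      then show False using contr by blast
    qed
  qed
qed

section \<open>Large classes by relative entropy, and the potential of a family of parts\<close>

lemma sum_Pow_power_card:
  fixes c :: real
  assumes "finite I"
  shows "(\<Sum>P\<in>Pow I. c ^ card P) = (1 + c) ^ card I"
  using prod_add[OF assms, of "\<lambda>_. c" "\<lambda>_. 1"] by (simp add: add.commute)

definition average :: "('a \<Rightarrow> real) \<Rightarrow> 'a set \<Rightarrow> real" where
  "average f A = (\<Sum>x\<in>A. f x) / card A"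

text \<open>In a class drawn with probability proportional to its size, \<open>H\<close> keeps its
  expected average. The allowance \<open>card P * ln \<kappa>\<close> lets classes with large
  \<open>P\<close> be small; for large \<open>\<kappa>\<close> the loss is then far below the
  \<open>card I * ln 2\<close> of a plain pigeonhole.\<close>

lemma ex_large_class:
  fixes \<kappa> :: real and f :: "'a \<Rightarrow> 'b set" and H :: "'a \<Rightarrow> real"
  assumes "finite Y" "Y \<noteq> {}" "finite I" "\<And>y. y \<in> Y \<Longrightarrow> f y \<subseteq> I" "\<kappa> > 0"
  obtains P Z where "P \<subseteq> I" "Z = {y \<in> Y. f y = P}" "Z \<noteq> {}"
    "ln (card Y) + average H Y - card I * ln (1 + 1 / \<kappa>) \<le> ln (card Z) + card P * ln \<kappa> + average H Z"
proof (rule ccontr)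
  assume contr: "\<not> thesis"
  note large = that
  define Z where "Z P = {y \<in> Y. f y = P}" for P
  define p where "p P = real (card (Z P)) / card Y" for P
  \<comment> \<open>The claim is Gibbs' inequality for the class frequencies \<open>p\<close> against the distribution \<open>q\<close> on the
    subsets of \<open>I\<close>, which favours small sets.\<close>
  define q where "q P = (1 / \<kappa>) ^ card P / (1 + 1 / \<kappa>) ^ card I" for P :: "'b set"
  have cY: "real (card Y) > 0" using assms(1,2) by (simp add: card_gt_0_iff)
  have fin: "finite (f ` Y)" "finite (Z P)" for P using assms(1) by (auto simp: Z_def)
  have Z_pos: "Z P \<noteq> {}" "real (card (Z P)) > 0" if "P \<in> f ` Y" for P
    using that fin by (auto simp: Z_def card_gt_0_iff)
  have \<kappa>1: "1 + 1 / \<kappa> > 0" using assms(5) by (simp add: add_pos_pos)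
  have sum_Y: "(\<Sum>P\<in>f ` Y. \<Sum>y\<in>Z P. h y) = (\<Sum>y\<in>Y. h y)" for h :: "'a \<Rightarrow> real"
    unfolding Z_def by (rule sum.group) (use assms(1) in auto)
  have sum_p: "(\<Sum>P\<in>f ` Y. p P) = 1"
    using sum_Y[of "\<lambda>_. 1"] cY by (simp add: p_def flip: sum_divide_distrib)
  have less: "p P * (ln (p P) + card P * ln \<kappa> + average H (Z P)) <
      p P * (average H Y - card I * ln (1 + 1 / \<kappa>))" if P: "P \<in> f ` Y" for P
  proof -
    have "P \<subseteq> I" using P assms(4) by blast
    then have "ln (card (Z P)) + card P * ln \<kappa> + average H (Z P) <
        ln (card Y) + average H Y - card I * ln (1 + 1 / \<kappa>)"
      using contr large[OF \<open>P \<subseteq> I\<close> Z_def Z_pos(1)[OF P]] by (meson not_le)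
    moreover have "ln (p P) = ln (card (Z P)) - ln (card Y)"
      using Z_pos(2)[OF P] cY by (simp add: p_def ln_div)
    moreover have "p P > 0" using Z_pos(2)[OF P] cY by (simp add: p_def)
    ultimately show ?thesis by simp
  qed
  have "(\<Sum>P\<in>f ` Y. p P * (ln (p P) + card P * ln \<kappa> + average H (Z P))) <
      (\<Sum>P\<in>f ` Y. p P * (average H Y - card I * ln (1 + 1 / \<kappa>)))"
    using assms(2) fin less by (intro sum_strict_mono) auto
  also have "\<dots> = average H Y - card I * ln (1 + 1 / \<kappa>)"
    by (simp add: sum_p flip: sum_distrib_right)
  also have "(\<Sum>P\<in>f ` Y. p P * (ln (p P) + card P * ln \<kappa> + average H (Z P))) =
      (\<Sum>P\<in>f ` Y. p P * (ln (p P) + card P * ln \<kappa>)) + average H Y"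
  proof -
    have "(\<Sum>P\<in>f ` Y. p P * average H (Z P)) = (\<Sum>P\<in>f ` Y. (\<Sum>y\<in>Z P. H y) / card Y)"
      by (intro sum.cong refl) (use Z_pos in \<open>simp add: p_def average_def\<close>)
    also have "\<dots> = average H Y" by (simp add: sum_Y average_def flip: sum_divide_distrib)
    finally show ?thesis by (simp add: distrib_left sum.distrib)
  qed
  finally have neg: "(\<Sum>P\<in>f ` Y. p P * (ln (p P) + card P * ln \<kappa>)) < - (card I * ln (1 + 1 / \<kappa>))" by simp
  have "p P - q P \<le> p P * (ln (p P) + card P * ln \<kappa> + card I * ln (1 + 1 / \<kappa>))" if P: "P \<in> f ` Y" for P
  proof -
    have pos: "p P > 0" "q P > 0" using Z_pos(2)[OF P] cY assms(5) \<kappa>1 by (simp_all add: p_def q_def)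
    have "ln (q P) = - card P * ln \<kappa> - card I * ln (1 + 1 / \<kappa>)"
      using assms(5) \<kappa>1 by (simp add: q_def ln_div ln_mult ln_realpow ln_inverse divide_inverse)
    then have eq: "ln (p P) + card P * ln \<kappa> + card I * ln (1 + 1 / \<kappa>) = - ln (q P / p P)"
      using pos by (simp add: ln_div)
    have "p P * ln (q P / p P) \<le> p P * (q P / p P - 1)"
      using pos ln_le_minus_one[of "q P / p P"] by (intro mult_left_mono) auto
    then show ?thesis using pos unfolding eq by (simp add: algebra_simps)
  qed
  then have "(\<Sum>P\<in>f ` Y. p P - q P) \<le>
      (\<Sum>P\<in>f ` Y. p P * (ln (p P) + card P * ln \<kappa> + card I * ln (1 + 1 / \<kappa>)))"
    by (rule sum_mono)
  also have "\<dots> = (\<Sum>P\<in>f ` Y. p P * (ln (p P) + card P * ln \<kappa>)) + card I * ln (1 + 1 / \<kappa>)"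
    by (simp add: sum.distrib distrib_left sum_p flip: sum_distrib_right)
  also have "\<dots> < 0" using neg by simp
  finally have "1 < (\<Sum>P\<in>f ` Y. q P)" by (simp add: sum_subtractf sum_p)
  also have "\<dots> \<le> (\<Sum>P\<in>Pow I. q P)"
    using assms(3-5) \<kappa>1 by (intro sum_mono2) (auto simp: q_def)
  also have "\<dots> = 1"
    using sum_Pow_power_card[OF assms(3), of "1 / \<kappa>"] \<kappa>1 by (simp add: q_def flip: sum_divide_distrib)
  finally show False by simp
qed

definition neighbours :: "'a set set \<Rightarrow> 'a \<Rightarrow> 'a set \<Rightarrow> 'a set" where
  "neighbours E y A = {x \<in> A. {x, y} \<in> E}"

definition density :: "'a set set \<Rightarrow> 'a set \<Rightarrow> 'a set \<Rightarrow> real" where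
  "density E A B = average (\<lambda>y. card (neighbours E y A) / card A) B"

lemma sum_card_neighbours:
  assumes "finite A" "finite B"
  shows "(\<Sum>y\<in>B. real (card (neighbours E y A))) = (\<Sum>x\<in>A. real (card (neighbours E x B)))"
proof -
  have *: "real (card (neighbours E y A)) = (\<Sum>x\<in>A. of_bool ({x, y} \<in> E))" if "finite A" for y A
    using that by (simp add: neighbours_def sum.If_cases of_bool_def Int_def)
  have "(\<Sum>y\<in>B. real (card (neighbours E y A))) = (\<Sum>y\<in>B. \<Sum>x\<in>A. of_bool ({x, y} \<in> E))"
    using assms by (simp add: *)
  also have "\<dots> = (\<Sum>x\<in>A. \<Sum>y\<in>B. of_bool ({y, x} \<in> E))"
    by (subst sum.swap) (simp add: insert_commute)
  finally show ?thesis using assms by (simp add: *)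
qed

lemma density_sym:
  assumes "finite A" "finite B"
  shows "density E A B = density E B A"
  using sum_card_neighbours[OF assms, of E]
  by (simp add: density_def average_def mult.commute flip: sum_divide_distrib)

lemma density_nonneg: "0 \<le> density E A B"
  by (simp add: density_def average_def sum_nonneg)

text \<open>Up to an additive term, a lower bound for the independent set that can be extracted from the parts
  \<open>Y j\<close>.  The density term pays both for deleting the vertices of a chosen \<open>s\<close>-set that have neighbours
  in other parts and for the shrinking of those parts.\<close>

definition potential :: "'a set set \<Rightarrow> real \<Rightarrow> nat \<Rightarrow> 'i set \<Rightarrow> ('i \<Rightarrow> 'a set) \<Rightarrow> real" where
  "potential E \<kappa> s J Y = (\<Sum>j\<in>J. ln (card (Y j)) / ln \<kappa>)
     - 2 * real s * (\<Sum>i\<in>J. \<Sum>j\<in>J - {i}. density E (Y i) (Y j))"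

text \<open>The double sum runs over ordered pairs and \<open>density\<close> is symmetric, so each
  new pair counts twice and the factor 2 becomes 4.\<close>

lemma potential_insert:
  assumes "finite J" "j \<notin> J" "\<And>i. i \<in> insert j J \<Longrightarrow> finite (Y i)"
  shows "potential E \<kappa> s (insert j J) Y =
    potential E \<kappa> s J Y + ln (card (Y j)) / ln \<kappa> - 4 * real s * (\<Sum>i\<in>J. density E (Y i) (Y j))"
proof -
  have "(\<Sum>i\<in>J. \<Sum>l\<in>insert j J - {i}. density E (Y i) (Y l)) =
      (\<Sum>i\<in>J. density E (Y i) (Y j) + (\<Sum>l\<in>J - {i}. density E (Y i) (Y l)))"
  proof (rule sum.cong[OF refl])
    fix i assume "i \<in> J"
    then have "insert j J - {i} = insert j (J - {i})" using assms(2) by blast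
    then show "(\<Sum>l\<in>insert j J - {i}. density E (Y i) (Y l)) =
        density E (Y i) (Y j) + (\<Sum>l\<in>J - {i}. density E (Y i) (Y l))"
      using assms(1,2) by simp
  qed
  moreover have "(\<Sum>l\<in>insert j J - {j}. density E (Y j) (Y l)) = (\<Sum>i\<in>J. density E (Y i) (Y j))"
    using assms by (intro sum.cong density_sym) auto
  ultimately show ?thesis
    using assms(1,2) by (simp add: potential_def sum.distrib algebra_simps)
qed

lemma average_lincomb:
  assumes "finite J"
  shows "average (\<lambda>y. a * g y + b * (\<Sum>i\<in>J. h i y)) A = a * average g A + b * (\<Sum>i\<in>J. average (h i) A)"
  using assms
  by (simp add: average_def sum.distrib sum.swap[of _ J] flip: sum_distrib_left sum_divide_distrib)
     (simp add: add_divide_distrib)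

text \<open>Induction over the set of parts already refined: each further part is cut down by
  \<open>ex_large_class\<close>, with \<open>H\<close> chosen so that the change of the potential is
  controlled against the current state of all other parts.\<close>

lemma refine_to_constant_neighbourhoods:
  fixes Y :: "'i \<Rightarrow> 'a set" and \<kappa> :: real
  assumes "finite J" "finite I" "\<kappa> > 1" "\<And>j. j \<in> J \<Longrightarrow> finite (Y j) \<and> Y j \<noteq> {}"
  obtains P Z where "\<And>j. j \<in> J \<Longrightarrow> P j \<subseteq> I \<and> Z j \<subseteq> Y j \<and> Z j \<noteq> {} \<and> (\<forall>y\<in>Z j. neighbours E y I = P j)"
    "potential E \<kappa> s J Y - 2 * (\<Sum>j\<in>J. average (\<lambda>y. card (neighbours E y I)) (Y j))
       - card J * (card I * ln (1 + 1 / \<kappa>) / ln \<kappa>) \<le> potential E \<kappa> s J Z - (\<Sum>j\<in>J. real (card (P j)))"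
proof -
  have ln\<kappa>: "ln \<kappa> > 0" using assms(3) by simp
  define err where "err = card I * ln (1 + 1 / \<kappa>) / ln \<kappa>"
  have "\<exists>P Z. (\<forall>j\<in>J. Z j \<subseteq> Y j \<and> Z j \<noteq> {}) \<and> (\<forall>j\<in>J - J'. Z j = Y j) \<and>
      (\<forall>j\<in>J'. P j \<subseteq> I \<and> (\<forall>y\<in>Z j. neighbours E y I = P j)) \<and>
      potential E \<kappa> s J Y - 2 * (\<Sum>j\<in>J'. average (\<lambda>y. card (neighbours E y I)) (Y j)) - card J' * err
        \<le> potential E \<kappa> s J Z - (\<Sum>j\<in>J'. real (card (P j)))" if "J' \<subseteq> J" for J'
    using finite_subset[OF that assms(1)] that
  proof (induction J' rule: finite_induct)
    case empty
    show ?case using assms(4) by (intro exI[of _ "\<lambda>_. {}"] exI[of _ Y]) simp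
  next
    case (insert j J')
    then have "J' \<subseteq> J" by blast
    from insert.IH[OF this] obtain P Z where Z: "\<forall>i\<in>J. Z i \<subseteq> Y i \<and> Z i \<noteq> {}" "\<forall>i\<in>J - J'. Z i = Y i"
        and P: "\<forall>i\<in>J'. P i \<subseteq> I \<and> (\<forall>y\<in>Z i. neighbours E y I = P i)"
        and le: "potential E \<kappa> s J Y - 2 * (\<Sum>j\<in>J'. average (\<lambda>y. card (neighbours E y I)) (Y j)) - card J' * err
          \<le> potential E \<kappa> s J Z - (\<Sum>j\<in>J'. real (card (P j)))"
      by (elim exE conjE) (rule that)
    have j: "j \<in> J" "Z j = Y j" "finite (Y j)" "Y j \<noteq> {}" using insert.hyps insert.prems Z(2) assms(4)[of j] by auto
    have finZ: "finite (Z i)" if "i \<in> J" for i using Z(1) that assms(4)[OF that] finite_subset by blast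
    define g where "g y = real (card (neighbours E y I))" for y
    define h where "h i y = card (neighbours E y (Z i)) / card (Z i)" for i y
    \<comment> \<open>Of the two units charged per vertex of \<open>Q\<close>, one repays the
      allowance \<open>card Q * ln \<kappa>\<close> of \<open>ex_large_class\<close> and the other
      becomes the loss \<open>card Q\<close>. The second coefficient is that of
      \<open>potential_insert\<close>, scaled by \<open>ln \<kappa>\<close>.\<close>
    define H where "H y = - (2 * ln \<kappa>) * g y + - (4 * real s * ln \<kappa>) * (\<Sum>i\<in>J - {j}. h i y)" for y
    obtain Q A where QA: "Q \<subseteq> I" "A = {y \<in> Y j. neighbours E y I = Q}" "A \<noteq> {}"
        "ln (card (Y j)) + average H (Y j) - card I * ln (1 + 1 / \<kappa>) \<le>
         ln (card A) + card Q * ln \<kappa> + average H A"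
      using assms(2,3) j(3,4)
      by (rule_tac ex_large_class[of "Y j" I "\<lambda>y. neighbours E y I" \<kappa> H]) (auto simp: neighbours_def)
    have avg_H: "average H B = - (2 * ln \<kappa>) * average g B
        - (4 * real s * ln \<kappa>) * (\<Sum>i\<in>J - {j}. density E (Z i) B)" for B
    proof -
      have "H = (\<lambda>y. - (2 * ln \<kappa>) * g y + - (4 * real s * ln \<kappa>) * (\<Sum>i\<in>J - {j}. h i y))"
        by (simp add: H_def fun_eq_iff)
      moreover have "density E (Z i) B = average (h i) B" for i
        by (simp add: density_def h_def[abs_def])
      ultimately show ?thesis
        using average_lincomb[of "J - {j}" "- (2 * ln \<kappa>)" g "- (4 * real s * ln \<kappa>)" h B] assms(1) by simp
    qed
    have finA: "finite A" using QA(2) j(3) by simp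
    have "average g A = average (\<lambda>_. real (card Q)) A"
      unfolding average_def by (intro arg_cong2[where f = divide] sum.cong) (auto simp: QA(2) g_def)
    then have avg_A: "average g A = card Q"
      using QA(3) finA by (simp add: average_def card_gt_0_iff)
    have step: "ln (card (Y j)) / ln \<kappa> - 4 * real s * (\<Sum>i\<in>J - {j}. density E (Z i) (Y j)) - 2 * average g (Y j) - err \<le>
        ln (card A) / ln \<kappa> - 4 * real s * (\<Sum>i\<in>J - {j}. density E (Z i) A) - card Q"
      using divide_right_mono[OF QA(4), of "ln \<kappa>"] ln\<kappa> unfolding avg_H avg_A err_def
      by (simp add: add_divide_distrib diff_divide_distrib)
    let ?Z = "Z(j := A)"
    have pot: "potential E \<kappa> s J (Z(j := B)) = potential E \<kappa> s (J - {j}) Z + ln (card B) / ln \<kappa>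
        - 4 * real s * (\<Sum>i\<in>J - {j}. density E (Z i) B)" if "finite B" for B
    proof -
      have "potential E \<kappa> s (insert j (J - {j})) (Z(j := B)) =
          potential E \<kappa> s (J - {j}) (Z(j := B)) + ln (card ((Z(j := B)) j)) / ln \<kappa>
            - 4 * real s * (\<Sum>i\<in>J - {j}. density E ((Z(j := B)) i) ((Z(j := B)) j))"
        using assms(1) finZ that by (intro potential_insert) auto
      moreover have "potential E \<kappa> s (J - {j}) (Z(j := B)) = potential E \<kappa> s (J - {j}) Z"
        unfolding potential_def by (intro arg_cong2[where f = minus] arg_cong2[where f = times] sum.cong) auto
      moreover have "(\<Sum>i\<in>J - {j}. density E ((Z(j := B)) i) ((Z(j := B)) j)) =
          (\<Sum>i\<in>J - {j}. density E (Z i) B)" by (intro sum.cong) auto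
      ultimately show ?thesis using j(1) by (simp only: insert_Diff fun_upd_same)
    qed
    have "potential E \<kappa> s J Z - 2 * average g (Y j) - err \<le> potential E \<kappa> s J ?Z - card Q"
    proof -
      have "Z(j := Y j) = Z" using fun_upd_triv[of Z j] j(2) by (simp only:)
      then show ?thesis using pot[OF finA] pot[OF j(3)] step by simp
    qed
    moreover have "(\<Sum>i\<in>insert j J'. real (card ((P(j := Q)) i))) = card Q + (\<Sum>i\<in>J'. real (card (P i)))"
      using insert.hyps by (auto intro!: sum.cong)
    ultimately have "potential E \<kappa> s J Y - 2 * (\<Sum>i\<in>insert j J'. average (\<lambda>y. card (neighbours E y I)) (Y i))
        - card (insert j J') * err \<le> potential E \<kappa> s J ?Z - (\<Sum>i\<in>insert j J'. real (card ((P(j := Q)) i)))"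
      using le insert.hyps by (simp add: g_def[abs_def] algebra_simps)
    moreover have "\<forall>i\<in>J. ?Z i \<subseteq> Y i \<and> ?Z i \<noteq> {}"
    proof
      fix i assume "i \<in> J"
      then show "?Z i \<subseteq> Y i \<and> ?Z i \<noteq> {}"
        using Z(1) QA(3) Collect_subset[of "Y j"] unfolding QA(2) by (cases "i = j") simp_all
    qed
    moreover have "\<forall>i\<in>J - insert j J'. ?Z i = Y i" using Z(2) by simp
    moreover have "\<forall>i\<in>insert j J'. (P(j := Q)) i \<subseteq> I \<and> (\<forall>y\<in>?Z i. neighbours E y I = (P(j := Q)) i)"
    proof
      fix i assume "i \<in> insert j J'"
      then show "(P(j := Q)) i \<subseteq> I \<and> (\<forall>y\<in>?Z i. neighbours E y I = (P(j := Q)) i)"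
        using P QA(1,2) by (cases "i = j") simp_all
    qed
    ultimately show ?case by blast
  qed
  from this[OF order_refl] obtain P Z where "\<forall>j\<in>J. Z j \<subseteq> Y j \<and> Z j \<noteq> {}"
      "\<forall>j\<in>J. P j \<subseteq> I \<and> (\<forall>y\<in>Z j. neighbours E y I = P j)"
    and le: "potential E \<kappa> s J Y - 2 * (\<Sum>j\<in>J. average (\<lambda>y. card (neighbours E y I)) (Y j)) - card J * err
      \<le> potential E \<kappa> s J Z - (\<Sum>j\<in>J. real (card (P j)))"
    by (elim exE conjE) (rule that)
  then show thesis by (intro that[OF _ le[unfolded err_def]]) blast
qed

text \<open>Markov's inequality: at most half of the points exceed twice the average.\<close>

lemma many_below_twice_average:
  assumes "finite Y" "\<And>x. x \<in> Y \<Longrightarrow> 0 \<le> w x"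
  shows "card Y \<le> 2 * card {x \<in> Y. w x \<le> 2 * average w Y}"
proof -
  define X where "X = {x \<in> Y. w x \<le> 2 * average w Y}"
  define B where "B = Y - X"
  have fin: "finite X" "finite B" "X \<subseteq> Y" "B \<subseteq> Y" using assms(1) by (auto simp: X_def B_def)
  have "2 * card B \<le> card Y"
  proof (cases "B = {}")
    case False
    then have "Y \<noteq> {}" using fin by blast
    then have cY: "real (card Y) > 0" using assms(1) by (simp add: card_gt_0_iff)
    have "real (card B) * (2 * average w Y) = (\<Sum>x\<in>B. 2 * average w Y)" by simp
    also have "\<dots> < (\<Sum>x\<in>B. w x)"
      using False fin by (intro sum_strict_mono) (auto simp: B_def X_def)
    also have "\<dots> \<le> (\<Sum>x\<in>Y. w x)"
      using assms fin by (intro sum_mono2) auto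
    also have "\<dots> = real (card Y) * average w Y" using cY by (simp add: average_def)
    finally have less: "(2 * real (card B)) * average w Y < real (card Y) * average w Y" by simp
    have "average w Y \<ge> 0" using assms(2) by (simp add: average_def sum_nonneg)
    with less have "2 * real (card B) < real (card Y)" by (simp add: mult_less_cancel_right)
    then show ?thesis by linarith
  qed simp
  moreover have "card Y = card X + card B"
    using fin assms(1) by (simp add: B_def card_Diff_subset card_mono)
  ultimately show ?thesis unfolding X_def[symmetric] by linarith
qed

text \<open>Parts are removed one at a time. A part with fewer than \<open>2 * m\<close> vertices is
  dropped, at the price \<open>ln (2 * m) / ln \<kappa>\<close>. Any other part yields an
  independent \<open>s\<close>-set \<open>I\<close>; the remaining parts are refined to constant
  neighbourhoods in \<open>I\<close>, and the vertices of \<open>I\<close> lying in one of these are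
  deleted.\<close>

lemma indep_of_potential:
  fixes Y :: "'i \<Rightarrow> 'a set" and E :: "'a set set" and m s :: nat and \<kappa> :: real
  assumes "finite J" "\<kappa> > 1" "m > 0"
    and "\<And>j. j \<in> J \<Longrightarrow> finite (Y j) \<and> Y j \<noteq> {} \<and> real (card (Y j)) \<le> 2 * m * \<kappa> ^ s"
    and "\<And>i j. i \<in> J \<Longrightarrow> j \<in> J \<Longrightarrow> i \<noteq> j \<Longrightarrow> Y i \<inter> Y j = {}"
    and "\<And>X. X \<subseteq> (\<Union>j\<in>J. Y j) \<Longrightarrow> m \<le> card X \<Longrightarrow> \<exists>I\<subseteq>X. card I = s \<and> indep I E"
  shows "\<exists>U\<subseteq>(\<Union>j\<in>J. Y j). indep U E \<and>
    potential E \<kappa> s J Y - card J * (ln (2 * m) / ln \<kappa>) - (card J)\<^sup>2 * (s * ln (1 + 1 / \<kappa>) / ln \<kappa>) \<le> card U"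
  using assms(1,4-6)
proof (induction J arbitrary: Y rule: finite_induct)
  case empty
  show ?case by (intro exI[of _ "{}"]) (simp add: potential_def)
next
  case (insert j J)
  have ln\<kappa>: "ln \<kappa> > 0" using assms(2) by simp
  define err where "err = s * ln (1 + 1 / \<kappa>) / ln \<kappa>"
  define c where "c = ln (2 * m) / ln \<kappa>"
  define \<delta> where "\<delta> = (\<Sum>i\<in>J. density E (Y i) (Y j))"
  have err: "err \<ge> 0" using ln\<kappa> assms(2) by (simp add: err_def)
  have \<delta>: "\<delta> \<ge> 0" by (simp add: \<delta>_def sum_nonneg density_nonneg)
  have Yj: "finite (Y j)" "Y j \<noteq> {}" "real (card (Y j)) \<le> 2 * m * \<kappa> ^ s"
    and Y: "\<And>i. i \<in> J \<Longrightarrow> finite (Y i) \<and> Y i \<noteq> {} \<and> real (card (Y i)) \<le> 2 * m * \<kappa> ^ s"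
    using insert.prems(1) by auto
  have pos: "real (card (Y j)) > 0" using Yj by (simp add: card_gt_0_iff)
  have pot: "potential E \<kappa> s (insert j J) Y = potential E \<kappa> s J Y + ln (card (Y j)) / ln \<kappa> - 4 * real s * \<delta>"
    unfolding \<delta>_def using insert.hyps insert.prems(1) by (intro potential_insert) auto
  \<comment> \<open>Removing a part causes \<open>card J\<close> refinement errors, which the growth
    of the square absorbs.\<close>
  have sq: "real ((card (insert j J))\<^sup>2) * err \<ge> real ((card J)\<^sup>2) * err + card J * err"
  proof -
    have "real ((card J)\<^sup>2) + card J \<le> real ((card (insert j J))\<^sup>2)"
      using insert.hyps by (simp add: power2_eq_square algebra_simps)
    from mult_right_mono[OF this err] show ?thesis by (simp add: distrib_right)
  qed
  show ?case
  proof (cases "card (Y j) < 2 * m")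
    case True
    then have small: "ln (card (Y j)) / ln \<kappa> \<le> c"
      using ln\<kappa> pos by (simp add: c_def divide_right_mono)
    have nonneg: "4 * real s * \<delta> \<ge> 0" "card J * err \<ge> 0" using \<delta> err by simp_all
    have "\<exists>U\<subseteq>(\<Union>j\<in>J. Y j). indep U E \<and>
        potential E \<kappa> s J Y - card J * c - (card J)\<^sup>2 * err \<le> card U"
      unfolding c_def err_def
    proof (rule insert.IH)
      show "\<exists>I\<subseteq>X. card I = s \<and> indep I E" if "X \<subseteq> (\<Union>j\<in>J. Y j)" "m \<le> card X" for X
        using insert.prems(3)[of X] that by blast
    qed (use Y insert.prems(2) in auto)
    then obtain U where U: "U \<subseteq> (\<Union>j\<in>J. Y j)" "indep U E"
        "potential E \<kappa> s J Y - card J * c - (card J)\<^sup>2 * err \<le> card U" by blast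
    have "card (insert j J) * c = card J * c + c" using insert.hyps by (simp add: algebra_simps)
    with U(3) small nonneg pot sq
    have "potential E \<kappa> s (insert j J) Y - card (insert j J) * c - (card (insert j J))\<^sup>2 * err \<le> card U"
      by linarith
    with U(1,2) show ?thesis unfolding c_def err_def by blast
  next
    case False
    define w where "w x = (\<Sum>i\<in>J. card (neighbours E x (Y i)) / card (Y i))" for x
    have avg_w: "average w (Y j) = \<delta>"
      using average_lincomb[OF insert.hyps(1), of 0 w 1 "\<lambda>i x. card (neighbours E x (Y i)) / card (Y i)" "Y j"]
      by (simp add: w_def[abs_def] \<delta>_def density_def)
    have "w x \<ge> 0" for x by (simp add: w_def sum_nonneg)
    \<comment> \<open>Of the at least \<open>2 * m\<close> vertices, half have total density at most
      \<open>2 * \<delta>\<close> into the other parts, enough for choosing \<open>I\<close> among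
      them.\<close>
    then have "m \<le> card {x \<in> Y j. w x \<le> 2 * \<delta>}"
      using many_below_twice_average[of "Y j" w] Yj(1) False by (simp add: avg_w)
    moreover have "{x \<in> Y j. w x \<le> 2 * \<delta>} \<subseteq> (\<Union>i\<in>insert j J. Y i)" by auto
    ultimately obtain I where I: "I \<subseteq> {x \<in> Y j. w x \<le> 2 * \<delta>}" "card I = s" "indep I E"
      using insert.prems(3) by blast
    have finI: "finite I" using I(1) Yj(1) finite_subset[of I "Y j"] by auto
    \<comment> \<open>The refinement doubles this amount, and \<open>4 * s * \<delta>\<close> is
      what \<open>pot\<close> sets aside for the part \<open>j\<close>.\<close>
    have avg_I: "(\<Sum>i\<in>J. average (\<lambda>y. card (neighbours E y I)) (Y i)) \<le> 2 * s * \<delta>"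
    proof -
      have "(\<Sum>i\<in>J. average (\<lambda>y. card (neighbours E y I)) (Y i)) =
          (\<Sum>i\<in>J. \<Sum>x\<in>I. card (neighbours E x (Y i)) / card (Y i))"
        using sum_card_neighbours[OF finI, of _ E] Y
        by (intro sum.cong refl) (simp add: average_def flip: sum_divide_distrib)
      also have "\<dots> = (\<Sum>x\<in>I. w x)" unfolding w_def by (rule sum.swap)
      also have "\<dots> \<le> (\<Sum>x\<in>I. 2 * \<delta>)" using I(1) by (intro sum_mono) auto
      finally show ?thesis by (simp add: I(2))
    qed
    obtain P Z where PZ: "\<And>i. i \<in> J \<Longrightarrow> P i \<subseteq> I \<and> Z i \<subseteq> Y i \<and> Z i \<noteq> {} \<and> (\<forall>y\<in>Z i. neighbours E y I = P i)"
      and le: "potential E \<kappa> s J Y - 2 * (\<Sum>i\<in>J. average (\<lambda>y. card (neighbours E y I)) (Y i))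
         - card J * err \<le> potential E \<kappa> s J Z - (\<Sum>i\<in>J. real (card (P i)))"
      using refine_to_constant_neighbourhoods[OF insert.hyps(1) finI assms(2), of Y E s] Y
      unfolding err_def I(2) by metis
    have subZ: "(\<Union>i\<in>J. Z i) \<subseteq> (\<Union>i\<in>J. Y i)" using PZ by blast
    have "\<exists>U\<subseteq>(\<Union>i\<in>J. Z i). indep U E \<and> potential E \<kappa> s J Z - card J * c - (card J)\<^sup>2 * err \<le> card U"
      unfolding c_def err_def
    proof (rule insert.IH)
      show "finite (Z i) \<and> Z i \<noteq> {} \<and> real (card (Z i)) \<le> 2 * m * \<kappa> ^ s" if "i \<in> J" for i
      proof -
        have "finite (Z i)" "card (Z i) \<le> card (Y i)"
          using PZ[OF that] Y[OF that] by (auto intro: finite_subset card_mono)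
        then show ?thesis using PZ[OF that] Y[OF that] by force
      qed
      show "Z i \<inter> Z l = {}" if "i \<in> J" "l \<in> J" "i \<noteq> l" for i l
        using PZ[OF that(1)] PZ[OF that(2)] insert.prems(2)[of i l] that by blast
      show "\<exists>I\<subseteq>X. card I = s \<and> indep I E" if "X \<subseteq> (\<Union>i\<in>J. Z i)" "m \<le> card X" for X
        using insert.prems(3)[of X] that subZ by blast
    qed
    then obtain U where U: "U \<subseteq> (\<Union>i\<in>J. Z i)" "indep U E"
        "potential E \<kappa> s J Z - card J * c - (card J)\<^sup>2 * err \<le> card U" by blast
    define I' where "I' = I - (\<Union>i\<in>J. P i)"
    have disj: "U \<inter> I' = {}"
    proof -
      have "Y j \<inter> (\<Union>i\<in>J. Y i) = {}"
        using insert.prems(2)[of j] insert.hyps(2) by fastforce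
      moreover have "U \<subseteq> (\<Union>i\<in>J. Y i)" using U(1) subZ by (rule order_trans)
      moreover have "I' \<subseteq> Y j" using I(1) by (auto simp: I'_def)
      ultimately show ?thesis by blast
    qed
    have "indep (U \<union> I') E"
    proof -
      have no: "{x, y} \<notin> E" if "x \<in> I'" "y \<in> U" for x y
      proof -
        obtain i where i: "i \<in> J" "y \<in> Z i" using U(1) \<open>y \<in> U\<close> by blast
        then have "x \<notin> neighbours E y I" using PZ[OF i(1)] \<open>x \<in> I'\<close> by (auto simp: I'_def)
        then show ?thesis using \<open>x \<in> I'\<close> by (simp add: neighbours_def I'_def)
      qed
      have "indep I' E" using I(3) by (rule smaller_indep) (auto simp: I'_def)
      with U(2) no show ?thesis
        unfolding indep_def by (metis Un_iff insert_commute)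
    qed
    moreover have "U \<union> I' \<subseteq> (\<Union>i\<in>insert j J. Y i)"
      using U(1) subZ I(1) by (auto simp: I'_def)
    moreover have "potential E \<kappa> s (insert j J) Y - card (insert j J) * c - (card (insert j J))\<^sup>2 * err \<le> card (U \<union> I')"
    proof -
      have finU: "finite U" using U(1) subZ Y insert.hyps(1) by (meson finite_UN finite_subset)
      have "(\<Union>i\<in>J. P i) \<subseteq> I" by (rule UN_least) (use PZ in blast)
      then have "finite (\<Union>i\<in>J. P i)" using finI by (rule finite_subset)
      then have "card I - card (\<Union>i\<in>J. P i) \<le> card I'"
        unfolding I'_def by (rule diff_card_le_card_Diff)
      moreover have "card (\<Union>i\<in>J. P i) \<le> (\<Sum>i\<in>J. card (P i))"
        by (rule card_UN_le[OF insert.hyps(1)])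
      ultimately have "s \<le> card I' + (\<Sum>i\<in>J. card (P i))" using I(2) by linarith
      then have "real s \<le> card I' + (\<Sum>i\<in>J. real (card (P i)))"
        by (simp flip: of_nat_sum of_nat_add)
      moreover have "card (U \<union> I') = card U + card I'"
        using disj finU finI by (simp add: card_Un_disjoint I'_def)
      \<comment> \<open>The cap on the sizes limits the contribution of the part to
        \<open>c + s\<close>, to be matched by the \<open>s\<close> vertices of
        \<open>I\<close>.\<close>
      moreover have "ln (card (Y j)) / ln \<kappa> \<le> c + s"
      proof -
        have "ln (card (Y j)) \<le> ln (2 * m * \<kappa> ^ s)" using Yj(3) pos by simp
        also have "\<dots> = ln (2 * m) + s * ln \<kappa>"
          using assms(2,3) by (simp add: ln_mult ln_realpow)
        finally have "ln (card (Y j)) / ln \<kappa> \<le> (ln (2 * m) + s * ln \<kappa>) / ln \<kappa>"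
          using ln\<kappa> by (simp add: divide_right_mono)
        then show ?thesis using ln\<kappa> by (simp add: c_def add_divide_distrib)
      qed
      moreover have "card (insert j J) * c = card J * c + c" using insert.hyps by (simp add: algebra_simps)
      ultimately show ?thesis using U(3) le avg_I pot sq by simp
    qed
    ultimately show ?thesis unfolding c_def err_def by blast
  qed
qed

section \<open>Edge-disjoint graphs on a common vertex set\<close>

lemma ex_disjoint_subsets_of_card:
  assumes "finite R" "C * M \<le> card R"
  shows "\<exists>Y. (\<forall>j<C. Y j \<subseteq> R \<and> card (Y j) = M) \<and> (\<forall>i<C. \<forall>j<C. i \<noteq> j \<longrightarrow> Y i \<inter> Y j = {})"
  using assms
proof (induction C arbitrary: R)
  case (Suc C)
  obtain A where A: "A \<subseteq> R" "card A = M" "finite A"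
    using obtain_subset_with_card_n[of M R] Suc.prems(2) by auto
  have "C * M \<le> card (R - A)" using A Suc.prems by (simp add: card_Diff_subset)
  with Suc.IH[of "R - A"] Suc.prems(1)
  obtain Y where Y: "\<forall>j<C. Y j \<subseteq> R - A \<and> card (Y j) = M" "\<forall>i<C. \<forall>j<C. i \<noteq> j \<longrightarrow> Y i \<inter> Y j = {}"
    by auto
  then show ?case
    using A by (intro exI[of _ "Y(C := A)"]) (auto simp: less_Suc_eq)
qed simp

text \<open>For each \<open>y\<close> the neighbourhoods in the different graphs are disjoint
  subsets of \<open>A\<close>, so their relative sizes add up to at most 1, and so does the average
  over \<open>B\<close>.\<close>

lemma sum_density_le_1:
  assumes "finite A" "finite T"
    and disj: "\<And>a b x y. a \<in> T \<Longrightarrow> b \<in> T \<Longrightarrow> a \<noteq> b \<Longrightarrow> x \<in> A \<Longrightarrow> y \<in> B \<Longrightarrow> \<not> ({x, y} \<in> E a \<and> {x, y} \<in> E b)"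
  shows "(\<Sum>a\<in>T. density (E a) A B) \<le> 1"
proof -
  have le: "(\<Sum>a\<in>T. real (card (neighbours (E a) y A)) / card A) \<le> 1" if "y \<in> B" for y
  proof -
    have "(\<Sum>a\<in>T. card (neighbours (E a) y A)) = card (\<Union>a\<in>T. neighbours (E a) y A)"
      using assms(1,2) disj that
      by (intro card_UN_disjoint[symmetric]) (auto simp: neighbours_def)
    also have "\<dots> \<le> card A" using assms(1) by (intro card_mono) (auto simp: neighbours_def)
    finally have "(\<Sum>a\<in>T. real (card (neighbours (E a) y A))) \<le> real (card A)"
      by (simp flip: of_nat_sum)
    then show ?thesis
      by (cases "card A = 0") (simp_all add: divide_le_eq_1 flip: sum_divide_distrib)
  qed
  have "(\<Sum>a\<in>T. density (E a) A B) = average (\<lambda>y. \<Sum>a\<in>T. real (card (neighbours (E a) y A)) / card A) B"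
    using average_lincomb[OF assms(2), of 0 "\<lambda>_. 0" 1 "\<lambda>a y. real (card (neighbours (E a) y A)) / card A" B]
    by (simp add: density_def)
  also have "\<dots> \<le> 1"
    unfolding average_def using sum_mono[of B _ "\<lambda>_. 1", OF le]
    by (cases "card B = 0") (simp_all add: divide_le_eq_1)
  finally show ?thesis .
qed

lemma indep_in_one_of_disjoint_graphs:
  fixes E :: "'b \<Rightarrow> 'a set set" and C n :: nat
  defines "s \<equiv> 16 * C\<^sup>2"
  assumes "finite R" "card K = 8 * C + 1" "C \<ge> 1" "0 < n" "n \<le> 8 * C ^ 3"
    and large: "C * (2 * n ^ s * (8 * C + 1) ^ s) \<le> card R"
    and disj: "\<And>a b x y. a \<in> K \<Longrightarrow> b \<in> K \<Longrightarrow> a \<noteq> b \<Longrightarrow> x \<in> R \<Longrightarrow> y \<in> R \<Longrightarrow> x \<noteq> y \<Longrightarrow>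
      \<not> ({x, y} \<in> E a \<and> {x, y} \<in> E b)"
  shows "\<exists>a\<in>K. \<exists>S\<subseteq>R. card S = n \<and> indep S (E a)"
proof (rule ccontr)
  assume contr: "\<not> ?thesis"
  define \<kappa> :: real where "\<kappa> = 8 * C + 1"
  define m where "m = n ^ s"
  define M where "M = 2 * n ^ s * (8 * C + 1) ^ s"
  have finK: "finite K" using assms(3) card.infinite by fastforce
  \<comment> \<open>The graph of \<open>a1\<close> is set aside as a source of cliques;
    edge-disjointness makes these independent in each of the other \<open>8 * C\<close>
    graphs.\<close>
  obtain a1 where a1: "a1 \<in> K" using assms(3) by fastforce
  have block: "\<exists>I\<subseteq>X. card I = s \<and> indep I (E a)" if aX: "a \<in> K - {a1}" "X \<subseteq> R" "m \<le> card X" for a X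
  proof -
    have "finite X" using aX(2) assms(2) by (rule finite_subset)
    moreover have "\<not> (\<exists>S\<subseteq>X. card S = n \<and> indep S (E a1))"
      using contr a1 aX(2) by blast
    ultimately obtain I where I: "I \<subseteq> X" "card I = s" "clique I (E a1)"
      using clique_or_indep_of_power_le[of X n s "E a1"] aX(3) assms(5) unfolding m_def by blast
    have "indep I (E a)"
      unfolding indep_def
    proof (intro ballI impI)
      fix x y assume xy: "x \<in> I" "y \<in> I" "x \<noteq> y"
      then have "{x, y} \<in> E a1" using I(3) unfolding clique_def by blast
      moreover have "x \<in> R" "y \<in> R" using xy I(1) aX(2) by blast+
      ultimately show "{x, y} \<notin> E a" using disj[of a1 a x y] a1 aX(1) xy(3) by blast
    qed
    with I show ?thesis by blast
  qed
  obtain Y where Y: "\<And>j. j < C \<Longrightarrow> Y j \<subseteq> R \<and> card (Y j) = M"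
      and Y_disj: "\<And>i j. i < C \<Longrightarrow> j < C \<Longrightarrow> i \<noteq> j \<Longrightarrow> Y i \<inter> Y j = {}"
    using ex_disjoint_subsets_of_card[OF assms(2), of C M] large unfolding M_def by metis
  have finY: "finite (Y j)" if "j < C" for j using Y[OF that] assms(2) finite_subset by blast
  define \<Delta> where "\<Delta> a = (\<Sum>i<C. \<Sum>j\<in>{..<C} - {i}. density (E a) (Y i) (Y j))" for a
  \<comment> \<open>Each of the at most \<open>C\<^sup>2\<close> ordered pairs of parts has total
    density at most 1 over the \<open>8 * C\<close> graphs, so some graph gets at most
    \<open>C / 8\<close>.\<close>
  obtain a where a: "a \<in> K - {a1}" "\<Delta> a \<le> C / 8"
  proof -
    have "(\<Sum>a\<in>K - {a1}. \<Delta> a) = (\<Sum>i<C. \<Sum>j\<in>{..<C} - {i}. \<Sum>a\<in>K - {a1}. density (E a) (Y i) (Y j))"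
      unfolding \<Delta>_def by (subst sum.swap) (simp add: sum.swap[of _ "K - {a1}"])
    also have "\<dots> \<le> (\<Sum>i<C. \<Sum>j\<in>{..<C} - {i}. 1)"
    proof (intro sum_mono)
      fix i j assume i: "i \<in> {..<C}" and j: "j \<in> {..<C} - {i}"
      show "(\<Sum>a\<in>K - {a1}. density (E a) (Y i) (Y j)) \<le> 1"
      proof (rule sum_density_le_1)
        fix a b x y assume *: "a \<in> K - {a1}" "b \<in> K - {a1}" "a \<noteq> b" "x \<in> Y i" "y \<in> Y j"
        have "x \<in> R" "y \<in> R" "x \<noteq> y" using * i j Y[of i] Y[of j] Y_disj[of i j] by auto
        then show "\<not> ({x, y} \<in> E a \<and> {x, y} \<in> E b)" using disj[of a b x y] * by blast
      qed (use finY i finK in auto)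
    qed
    also have "\<dots> \<le> (\<Sum>i<C. real C)"
      by (intro sum_mono) (auto simp: card_Diff_subset)
    also have "\<dots> = (\<Sum>a\<in>K - {a1}. C / 8)"
      using a1 finK assms(3) by simp
    finally have "(\<Sum>a\<in>K - {a1}. \<Delta> a) \<le> (\<Sum>a\<in>K - {a1}. C / 8)" .
    moreover have "K - {a1} \<noteq> {}" using a1 assms(3,4) by (metis Suc_eq_plus1 card.empty card_Suc_Diff1
      finK finite.emptyI mult_is_0 nat.inject not_one_le_zero numeral_eq_Suc nat.distinct(1))
    ultimately have "\<exists>a\<in>K - {a1}. \<Delta> a \<le> C / 8"
      using sum_strict_mono[of "K - {a1}" "\<lambda>_. C / 8" \<Delta>] finK by (meson finite_Diff not_le)
    then show thesis using that by blast
  qed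
  have \<kappa>: "\<kappa> > 1" "ln \<kappa> \<ge> 1"
  proof -
    have "exp 1 \<le> \<kappa>" using exp_le assms(4) unfolding \<kappa>_def by (rule_tac order_trans[of _ 3]) auto
    then show "ln \<kappa> \<ge> 1" using ln_mono[of "exp 1" \<kappa>] by simp
    show "\<kappa> > 1" using assms(4) unfolding \<kappa>_def by simp
  qed
  have m: "m > 0" using assms(5) by (simp add: m_def)
  have M: "real M = 2 * m * \<kappa> ^ s" "M > 0"
    using assms(5) by (simp_all add: M_def m_def \<kappa>_def)
  have "\<exists>U\<subseteq>(\<Union>j<C. Y j). indep U (E a) \<and> potential (E a) \<kappa> s {..<C} Y
      - card {..<C} * (ln (2 * m) / ln \<kappa>) - (card {..<C})\<^sup>2 * (s * ln (1 + 1 / \<kappa>) / ln \<kappa>) \<le> card U"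
  proof (rule indep_of_potential)
    show "finite (Y j) \<and> Y j \<noteq> {} \<and> real (card (Y j)) \<le> 2 * m * \<kappa> ^ s" if "j \<in> {..<C}" for j
      using Y[of j] finY[of j] that M by auto
    show "\<exists>I\<subseteq>X. card I = s \<and> indep I (E a)" if "X \<subseteq> (\<Union>j<C. Y j)" "m \<le> card X" for X
      using block[OF a(1), of X] that Y by blast
  qed (use \<kappa> m Y_disj in auto)
  then obtain U where U: "U \<subseteq> (\<Union>j<C. Y j)" "indep U (E a)"
    and U_ge: "potential (E a) \<kappa> s {..<C} Y - C * (ln (2 * m) / ln \<kappa>) - C\<^sup>2 * (s * ln (1 + 1 / \<kappa>) / ln \<kappa>) \<le> card U"
    by auto
  have "n \<le> card U"
  proof -
    \<comment> \<open>By the choice of \<open>M\<close> every part contributes its allowance plus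
      \<open>s\<close>. Of \<open>C * s\<close> the densities take at most a quarter and the errors
      at most an eighth; the remaining \<open>5 / 8 * s * C\<close> equals
      \<open>10 * C ^ 3\<close>, which is at least \<open>n\<close>.\<close>
    have "ln (real M) = ln (2 * m) + s * ln \<kappa>"
      using M(1) m \<kappa>(1) by (simp add: ln_mult ln_realpow)
    then have "ln (real M) / ln \<kappa> = ln (2 * m) / ln \<kappa> + s"
      using \<kappa>(2) by (simp add: add_divide_distrib)
    then have "(\<Sum>j<C. ln (card (Y j)) / ln \<kappa>) = C * (ln (2 * m) / ln \<kappa>) + C * real s"
      using Y by (simp add: distrib_left)
    then have "potential (E a) \<kappa> s {..<C} Y - C * (ln (2 * m) / ln \<kappa>) = C * real s - 2 * real s * \<Delta> a"
      by (simp add: potential_def \<Delta>_def)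
    moreover have "2 * real s * \<Delta> a \<le> 2 * real s * (C / 8)" using a(2) by (intro mult_left_mono) auto
    moreover have "C\<^sup>2 * (s * ln (1 + 1 / \<kappa>) / ln \<kappa>) \<le> C\<^sup>2 * (s * (1 / (8 * C)))"
    proof -
      have "ln (1 + 1 / \<kappa>) \<le> 1 / \<kappa>" using \<kappa>(1) by (intro ln_add_one_self_le_self) auto
      also have "\<dots> \<le> 1 / (8 * C)" using assms(4) unfolding \<kappa>_def by (intro divide_left_mono) auto
      finally have "s * ln (1 + 1 / \<kappa>) \<le> s * (1 / (8 * C))" by (intro mult_left_mono) auto
      moreover have "s * ln (1 + 1 / \<kappa>) / ln \<kappa> \<le> s * ln (1 + 1 / \<kappa>) / 1"
        using \<kappa> by (intro divide_left_mono) auto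
      ultimately show ?thesis by (intro mult_left_mono) auto
    qed
    moreover have "C\<^sup>2 * (s * (1 / (8 * C))) = real s * C / 8"
      using assms(4) by (simp add: power2_eq_square)
    moreover have "2 * real s * (C / 8) = real s * C / 4" "C * real s = real s * C" by simp_all
    ultimately have "5 / 8 * (real s * C) \<le> card U" using U_ge by linarith
    moreover have "real n \<le> 5 / 8 * (real s * C)"
    proof -
      have "real n \<le> real (8 * C ^ 3)" using assms(6) by (rule of_nat_mono)
      also have "\<dots> \<le> 10 * real C ^ 3" by simp
      also have "\<dots> = 5 / 8 * (real s * C)" by (simp add: s_def power2_eq_square power3_eq_cube)
      finally show ?thesis .
    qed
    ultimately show ?thesis by linarith
  qed
  then obtain S where S: "S \<subseteq> U" "card S = n" by (rule obtain_subset_with_card_n)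
  moreover have "S \<subseteq> R" using S(1) U(1) Y by blast
  moreover have "indep S (E a)" using smaller_indep[OF U(2) S(1)] .
  ultimately show False using contr a(1) by blast
qed

section \<open>The upper bound for four vertices\<close>

text \<open>The first \<open>n ^ k\<close> vertices ensure that the red link of every later vertex
  has a \<open>k\<close>-clique among them; at least \<open>M\<close> later vertices share one
  clique \<open>K\<close> and form \<open>R\<close>. An edge inside \<open>R\<close> lying in the
  links of two vertices of \<open>K\<close> would complete a red 4-clique.\<close>

lemma ramsey_number_K4_star_upper:
  fixes C n :: nat
  defines "k \<equiv> 8 * C + 1" and "s \<equiv> 16 * C\<^sup>2"
  assumes "C \<ge> 1" "0 < n" "n \<le> 8 * C ^ 3"
  shows "ramsey_number (complete3 4) (star3 n) \<le> n ^ k + C * (2 * n ^ s * k ^ s) * (n ^ k) ^ k"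
proof (rule ramsey_number_le, unfold ramsey_prop_iff, rule allI, rule ccontr)
  fix \<chi> :: "nat set \<Rightarrow> colour"
  define M where "M = C * (2 * n ^ s * k ^ s)"
  define N where "N = n ^ k + M * (n ^ k) ^ k"
  assume "\<not> ((\<exists>K\<subseteq>{..<n ^ k + C * (2 * n ^ s * k ^ s) * (n ^ k) ^ k}. card K = 4 \<and> (\<forall>e\<in>[K]\<^bsup>3\<^esup>. \<chi> e = Red)) \<or>
    (\<exists>v<n ^ k + C * (2 * n ^ s * k ^ s) * (n ^ k) ^ k.
      \<exists>S\<subseteq>{..<n ^ k + C * (2 * n ^ s * k ^ s) * (n ^ k) ^ k} - {v}. card S = n \<and>
        (\<forall>x\<in>S. \<forall>y\<in>S. x \<noteq> y \<longrightarrow> \<chi> {v, x, y} = Blue)))"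
  then have no_red: "\<And>K. K \<subseteq> {..<N} \<Longrightarrow> card K = 4 \<Longrightarrow> \<exists>e\<in>[K]\<^bsup>3\<^esup>. \<chi> e \<noteq> Red"
    and no_blue: "\<And>v S. v < N \<Longrightarrow> S \<subseteq> {..<N} - {v} \<Longrightarrow> card S = n \<Longrightarrow>
      \<exists>x\<in>S. \<exists>y\<in>S. x \<noteq> y \<and> \<chi> {v, x, y} \<noteq> Blue"
    unfolding M_def[symmetric] N_def[symmetric] by blast+
  define E where "E v = {e. \<chi> (insert v e) = Red}" for v
  have not_indep: "\<not> indep S (E v)" if vS: "v < N" "S \<subseteq> {..<N} - {v}" "card S = n" for v S
  proof -
    obtain x y where "x \<in> S" "y \<in> S" "x \<noteq> y" "\<chi> {v, x, y} \<noteq> Blue"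
      using no_blue[OF vS] by blast
    moreover from this have "{x, y} \<in> E v" using colour.exhaust[of "\<chi> {v, x, y}"] by (auto simp: E_def)
    ultimately show ?thesis unfolding indep_def by blast
  qed
  define X where "X = {n ^ k..<N}"
  have card_X: "card X = M * (n ^ k) ^ k" by (simp add: X_def N_def)
  have "\<exists>K. K \<in> [{..<n ^ k}]\<^bsup>k\<^esup> \<and> clique K (E b)" if b: "b \<in> X" for b
  proof -
    have "\<not> (\<exists>S\<subseteq>{..<n ^ k}. card S = n \<and> indep S (E b))"
    proof
      assume "\<exists>S\<subseteq>{..<n ^ k}. card S = n \<and> indep S (E b)"
      then obtain S where S: "S \<subseteq> {..<n ^ k}" "card S = n" "indep S (E b)" by blast
      have "{..<n ^ k} \<subseteq> {..<N} - {b}" using b by (auto simp: X_def)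
      with S not_indep[of b S] b show False by (auto simp: X_def)
    qed
    then obtain K where "K \<subseteq> {..<n ^ k}" "card K = k" "clique K (E b)"
      using clique_or_indep_of_power_le[of "{..<n ^ k}" n k "E b"] assms(4) by auto
    then show ?thesis using finite_subset[of K "{..<n ^ k}"] by (auto simp: nsets_def)
  qed
  then obtain f where f: "\<And>b. b \<in> X \<Longrightarrow> f b \<in> [{..<n ^ k}]\<^bsup>k\<^esup> \<and> clique (f b) (E b)" by metis
  have M_pos: "M > 0" using assms(3,4) by (simp add: M_def k_def)
  then have "X \<noteq> {}" using card_X assms(4) by (metis card.empty mult_is_0 not_gr_zero power_not_zero)
  then have "[{..<n ^ k}]\<^bsup>k\<^esup> \<noteq> {}" using f by blast
  then obtain K where K: "K \<in> [{..<n ^ k}]\<^bsup>k\<^esup>"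
      and card_le: "card X \<le> card ([{..<n ^ k}]\<^bsup>k\<^esup>) * card {b \<in> X. f b = K}"
    using pigeonhole_card_vimage[of X "[{..<n ^ k}]\<^bsup>k\<^esup>" f] f
    by (auto simp: X_def finite_imp_finite_nsets image_subset_iff)
  define R where "R = {b \<in> X. f b = K}"
  have cardK: "card K = k" "K \<subseteq> {..<n ^ k}" using K by (auto simp: nsets_def)
  have "M \<le> card R"
  proof -
    have "M * (n ^ k) ^ k \<le> (n ^ k choose k) * card R"
      using card_le by (simp add: card_X R_def)
    also have "\<dots> \<le> (n ^ k) ^ k * card R"
      using binomial_le_pow[of k "n ^ k"] card_mono[OF _ cardK(2)] cardK(1)
      by (intro mult_le_mono1) simp
    finally show ?thesis using assms(4) by simp
  qed
  have "\<exists>a\<in>K. \<exists>S\<subseteq>R. card S = n \<and> indep S (E a)"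
  proof (rule indep_in_one_of_disjoint_graphs)
    show "finite R" by (simp add: R_def X_def)
    show "card K = 8 * C + 1" using cardK by (simp add: k_def)
    show "C * (2 * n ^ (16 * C\<^sup>2) * (8 * C + 1) ^ (16 * C\<^sup>2)) \<le> card R"
      using \<open>M \<le> card R\<close> by (simp add: M_def s_def k_def)
    fix a b x y assume ab: "a \<in> K" "b \<in> K" "a \<noteq> b" and xy: "x \<in> R" "y \<in> R" "x \<noteq> y"
    show "\<not> ({x, y} \<in> E a \<and> {x, y} \<in> E b)"
    proof
      assume *: "{x, y} \<in> E a \<and> {x, y} \<in> E b"
      have "clique K (E x)" "clique K (E y)" using f[of x] f[of y] xy by (auto simp: R_def)
      then have red: "\<chi> {x, a, b} = Red" "\<chi> {y, a, b} = Red" "\<chi> {a, x, y} = Red" "\<chi> {b, x, y} = Red"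
        using ab * by (auto simp: clique_def E_def)
      have less: "a < n ^ k" "b < n ^ k" "n ^ k \<le> x" "x < N" "n ^ k \<le> y" "y < N"
        using ab xy cardK(2) by (auto simp: R_def X_def)
      then have "card {a, b, x, y} = 4" "{a, b, x, y} \<subseteq> {..<N}" using ab(3) xy(3) by auto
      from no_red[OF this(2,1)] obtain e where e: "e \<in> [{a, b, x, y}]\<^bsup>3\<^esup>" "\<chi> e \<noteq> Red" by blast
      then obtain z where z: "z \<in> {a, b, x, y}" "e = {a, b, x, y} - {z}"
      proof -
        have "card ({a, b, x, y} - e) = 1"
          using e(1) \<open>card {a, b, x, y} = 4\<close> by (simp add: nsets_def card_Diff_subset)
        then obtain z where "{a, b, x, y} - e = {z}" by (meson card_1_singletonE)
        moreover have "e \<subseteq> {a, b, x, y}" using e(1) by (simp add: nsets_def)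
        ultimately show thesis using that[of z] by blast
      qed
      have "a \<noteq> x" "a \<noteq> y" "b \<noteq> x" "b \<noteq> y" using less by linarith+
      with ab(3) xy(3) have "{a, b, x, y} - {a} = {b, x, y}" "{a, b, x, y} - {b} = {a, x, y}"
          "{a, b, x, y} - {x} = {y, a, b}" "{a, b, x, y} - {y} = {x, a, b}" by auto
      then have "e \<in> {{x, a, b}, {y, a, b}, {a, x, y}, {b, x, y}}"
        unfolding z(2) using z(1) by (elim insertE) simp_all
      with red e(2) show False by blast
    qed
  qed (use assms in auto)
  then obtain a S where aS: "a \<in> K" "S \<subseteq> R" "card S = n" "indep S (E a)" by blast
  have "a < n ^ k" using aS(1) cardK(2) by auto
  then have "a < N" "S \<subseteq> {..<N} - {a}" using aS(2) by (auto simp: R_def X_def N_def)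
  then show False using not_indep aS(3,4) by blast
qed

section \<open>Choice of parameters and the explicit exponents\<close>

lemma one_less_ramsey_number:
  assumes "s \<ge> 2" "n \<ge> 1"
  shows "1 < ramsey_number (complete3 s) (star3 n)"
proof (rule less_ramsey_number)
  show "\<not> ramsey_prop (complete3 s) (star3 n) 1"
  proof
    assume "ramsey_prop (complete3 s) (star3 n) 1"
    then consider K where "K \<subseteq> {..<1 :: nat}" "card K = s"
      | v S where "v < (1 :: nat)" "S \<subseteq> {..<1} - {v}" "card S = n"
      unfolding ramsey_prop_iff by meson
    then show False
    proof cases
      case 1
      then show False using card_mono[OF _ 1(1)] assms(1) by simp
    next
      case 2
      then show False using card_mono[OF _ 2(2)] assms(2) by simp
    qed
  qed
qed

lemma K4_star_lower:
  assumes "n \<ge> 2"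
  shows "2 powr (1 / 576 * (log 2 (real n))\<^sup>2) \<le> real (ramsey_number (complete3 4) (star3 n))"
proof -
  define L where "L = log 2 (real n)"
  have L: "L \<ge> 1" using assms by (simp add: L_def le_log_iff)
  show ?thesis
  proof (cases "L < 24")
    case True
    \<comment> \<open>Below \<open>L = 24\<close> the exponent is at most 1, so a Ramsey number of
      at least 2 is enough.\<close>
    then have "L\<^sup>2 \<le> 24\<^sup>2" using L by (intro power_mono) auto
    then have "2 powr (1 / 576 * L\<^sup>2) \<le> 2 powr (1 :: real)" by (intro powr_mono) auto
    also have "\<dots> \<le> real (ramsey_number (complete3 4) (star3 n))"
      using one_less_ramsey_number[of 4 n] assms by simp
    finally show ?thesis by (simp add: L_def)
  next
    case False
    \<comment> \<open>The requirement on \<open>n\<close> is at most \<open>2 ^ (8 + 4 * D)\<close>,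
      hence at most \<open>2 ^ (12 * D)\<close>, which gives the divisor 12. Rounding down costs at
      most a factor 2 once \<open>L\<close> is at least 24, whence \<open>D \<ge> L / 24\<close> and
      the constant 576.\<close>
    define D where "D = nat \<lfloor>L / 12\<rfloor>"
    have "2 \<le> \<lfloor>L / 12\<rfloor>" using False by (simp add: le_floor_iff)
    then have D: "real D \<le> L / 12" "L / 12 < real D + 1" "D \<ge> 2"
      unfolding D_def using floor_correct[of "L / 12"] by linarith+
    have "6 * (24 * 4 ^ D * D\<^sup>2 + 1) \<le> n"
    proof -
      have "D\<^sup>2 \<le> (2 ^ D)\<^sup>2" by (intro power_mono) (auto simp: less_imp_le)
      then have D2: "D\<^sup>2 \<le> 4 ^ D" by (simp add: power2_eq_square flip: power_mult_distrib)
      have "6 * (24 * 4 ^ D * D\<^sup>2 + 1) = 144 * (4 ^ D * D\<^sup>2) + 6" by simp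
      also have "\<dots> \<le> 144 * (4 ^ D * 4 ^ D) + 6 * (4 ^ D * 4 ^ D)"
        using D2 by (intro add_mono mult_le_mono) auto
      also have "\<dots> \<le> 2 ^ 8 * (4 ^ D * 4 ^ D)" by simp
      also have "\<dots> = 2 ^ (8 + 4 * D)" by (simp add: power_add power_mult flip: power_mult_distrib)
      also have "\<dots> \<le> 2 ^ (12 * D)" using D(3) by (intro power_increasing) auto
      also have "\<dots> \<le> n"
      proof -
        have "real (2 ^ (12 * D)) = 2 powr real (12 * D)" by (subst powr_realpow) auto
        also have "\<dots> \<le> 2 powr L" using D(1) by (intro powr_mono) auto
        also have "\<dots> = n" using assms by (simp add: L_def)
        finally show ?thesis by linarith
      qed
      finally show ?thesis .
    qed
    from power_square_less_ramsey_number_K4_star[OF D(3) this]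
    have less: "2 ^ D\<^sup>2 < ramsey_number (complete3 4) (star3 n)" .
    have "L / 24 \<le> real D" using D(2) False by linarith
    then have "(L / 24)\<^sup>2 \<le> (real D)\<^sup>2" using L by (intro power_mono) auto
    then have "2 powr (1 / 576 * L\<^sup>2) \<le> 2 powr real (D\<^sup>2)"
      by (intro powr_mono) (auto simp: power_divide)
    also have "\<dots> = real (2 ^ D\<^sup>2)" by (subst powr_realpow) auto
    also have "\<dots> \<le> real (ramsey_number (complete3 4) (star3 n))" using less by (intro of_nat_mono) simp
    finally show ?thesis by (simp add: L_def)
  qed
qed

lemma K4_star_upper:
  assumes "n \<ge> 2"
  shows "real (ramsey_number (complete3 4) (star3 n)) \<le> 2 powr (180 * real n powr (2 / 3) * log 2 (real n))"
proof -
  define r where "r = real n powr (1 / 3)"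
  \<comment> \<open>Rounding down the cube root costs at most a factor 2, hence
    \<open>n \<le> 8 * C ^ 3\<close>.\<close>
  define C where "C = nat \<lfloor>r\<rfloor>"
  have r1: "r \<ge> 1" using assms by (simp add: r_def ge_one_powr_ge_zero)
  have "1 \<le> \<lfloor>r\<rfloor>" using r1 by (simp add: le_floor_iff)
  then have C: "real C \<le> r" "r < real C + 1" "C \<ge> 1"
    unfolding C_def using floor_correct[of r] by linarith+
  have r3: "r ^ 3 = real n"
    using assms by (simp add: r_def powr_powr flip: powr_realpow)
  have n_le: "n \<le> 8 * C ^ 3"
  proof -
    have "r \<le> 2 * real C" using C(2,3) by linarith
    then have "r ^ 3 \<le> (2 * real C) ^ 3" using r1 by (intro power_mono) auto
    then have "real n \<le> real (8 * C ^ 3)" by (simp add: r3 power_mult_distrib)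
    then show ?thesis by linarith
  qed
  have C_le: "C \<le> n"
  proof -
    have "real C ^ 1 \<le> real C ^ 3" using C(3) by (intro power_increasing) auto
    also have "\<dots> \<le> r ^ 3" using C(1) by (intro power_mono) auto
    finally show ?thesis using r3 by simp
  qed
  define k where "k = 8 * C + 1"
  define s where "s = 16 * C\<^sup>2"
  have CC: "C \<le> C\<^sup>2" "1 \<le> C\<^sup>2" using C(3) by (auto simp: power2_eq_square Suc_le_eq)
  have k9: "k \<le> 9 * C" using C(3) by (simp add: k_def)
  have "k \<le> n ^ 5"
  proof -
    have "2 ^ 4 \<le> n ^ 4" using assms by (intro power_mono) auto
    then have "9 * C \<le> n ^ 4 * n" using C_le by (intro mult_le_mono) auto
    then show ?thesis using k9 by (simp add: power_numeral_reduce mult.commute)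
  qed
  \<comment> \<open>In multiples of \<open>C\<^sup>2\<close>, the exponent gets at most 81 from
    \<open>k\<^sup>2\<close>, 96 from the two \<open>s\<close>-th powers, 2 from the factors
    \<open>C\<close> and 2, and one more from adding \<open>n ^ k\<close>.\<close>
  have "n ^ k + C * (2 * n ^ s * k ^ s) * (n ^ k) ^ k \<le> n ^ (180 * C\<^sup>2)"
  proof -
    have "C * (2 * n ^ s * k ^ s) * (n ^ k) ^ k \<le> n * (n * n ^ s * (n ^ 5) ^ s) * (n ^ k) ^ k"
      using assms C_le \<open>k \<le> n ^ 5\<close> by (intro mult_le_mono power_mono) auto
    also have "\<dots> = n ^ (2 + s + 5 * s + k\<^sup>2)"
      unfolding power_add power_mult[symmetric] power2_eq_square by (simp only: mult_ac)
    also have "\<dots> \<le> n ^ (179 * C\<^sup>2)"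
    proof (rule power_increasing)
      have "k\<^sup>2 \<le> (9 * C)\<^sup>2" using k9 by (intro power_mono) auto
      then show "2 + s + 5 * s + k\<^sup>2 \<le> 179 * C\<^sup>2"
        using CC by (simp add: s_def power_mult_distrib)
    qed (use assms in auto)
    finally have "C * (2 * n ^ s * k ^ s) * (n ^ k) ^ k \<le> n ^ (179 * C\<^sup>2)" .
    moreover have "n ^ k \<le> n ^ (179 * C\<^sup>2)"
      using k9 CC assms by (intro power_increasing) auto
    ultimately have "n ^ k + C * (2 * n ^ s * k ^ s) * (n ^ k) ^ k \<le> 2 * n ^ (179 * C\<^sup>2)" by linarith
    also have "\<dots> \<le> n * n ^ (179 * C\<^sup>2)" using assms by (intro mult_le_mono1)
    also have "\<dots> \<le> n ^ (180 * C\<^sup>2)"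
      using CC assms unfolding power_Suc[symmetric] by (intro power_increasing) auto
    finally show ?thesis .
  qed
  with ramsey_number_K4_star_upper[OF C(3) _ n_le] assms
  have "ramsey_number (complete3 4) (star3 n) \<le> n ^ (180 * C\<^sup>2)"
    unfolding k_def s_def by linarith
  then have "real (ramsey_number (complete3 4) (star3 n)) \<le> real (n ^ (180 * C\<^sup>2))" by (rule of_nat_mono)
  also have "\<dots> = 2 powr (180 * (real C)\<^sup>2 * log 2 (real n))"
  proof -
    have "real (n ^ (180 * C\<^sup>2)) = real n powr (180 * (real C)\<^sup>2)"
      using assms by (simp add: powr_realpow flip: powr_realpow)
    also have "\<dots> = (2 powr log 2 (real n)) powr (180 * (real C)\<^sup>2)" using assms by simp
    finally show ?thesis by (simp add: powr_powr mult.commute)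
  qed
  also have "\<dots> \<le> 2 powr (180 * real n powr (2 / 3) * log 2 (real n))"
  proof -
    have "(real C)\<^sup>2 \<le> r\<^sup>2" using C(1) by (intro power_mono) auto
    also have "\<dots> = real n powr (2 / 3)" using assms by (simp add: r_def powr_powr flip: powr_realpow)
    finally show ?thesis using assms by (intro powr_mono mult_right_mono) auto
  qed
  finally show ?thesis .
qed

lemma clique_star_lower:
  assumes "s \<ge> 5" "n \<ge> 2"
  shows "2 powr (1 / 64 * real n) \<le> real (ramsey_number (complete3 s) (star3 n))"
proof (cases "n < 32")
  case True
  then have "2 powr (1 / 64 * real n) \<le> 2 powr 1" by (intro powr_mono) auto
  also have "\<dots> \<le> real (ramsey_number (complete3 s) (star3 n))"
    using one_less_ramsey_number[of s n] assms by simp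
  finally show ?thesis .
next
  case False
  \<comment> \<open>Rounding down costs at most a factor 2, so \<open>n < 64 * e\<close>, which
    yields the constant 1/64.\<close>
  define e where "e = n div 32"
  have e_mod: "n = 32 * e + n mod 32" "n mod 32 < 32" by (simp_all add: e_def)
  then have e: "e \<ge> 1" "32 * e \<le> n" using False by linarith+
  with e_mod have "n < 64 * e" by linarith
  have "2 powr (1 / 64 * real n) \<le> 2 powr real e" using \<open>n < 64 * e\<close> by (intro powr_mono) auto
  also have "\<dots> = real (2 ^ e)" by (subst powr_realpow) auto
  also have "\<dots> \<le> real (ramsey_number (complete3 s) (star3 n))"
    using power_less_ramsey_number_clique_star[OF assms(1) e(1,2)] by (intro of_nat_mono) simp
  finally show ?thesis .
qed

lemma clique_star_upper:
  assumes "n \<ge> 2"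
  shows "real (ramsey_number (complete3 s) (star3 n)) \<le> 2 powr (2 * real (Suc s) * real s * real n)"
proof -
  have "real (ramsey_number (complete3 s) (star3 n)) \<le> real (2 ^ (Suc s * (s * Suc n)))"
    using ramsey_number_clique_star_upper[of s n] by (rule of_nat_mono)
  also have "\<dots> = 2 powr real (Suc s * (s * Suc n))" by (subst powr_realpow) auto
  also have "\<dots> \<le> 2 powr (2 * real (Suc s) * real s * real n)"
  proof (intro powr_mono)
    have "Suc s * (s * Suc n) \<le> Suc s * (s * (2 * n))"
      using assms by (intro mult_le_mono2) simp
    also have "\<dots> = 2 * Suc s * s * n" by (simp only: mult_ac)
    finally have "real (Suc s * (s * Suc n)) \<le> real (2 * Suc s * s * n)" by (rule of_nat_mono)
    then show "real (Suc s * (s * Suc n)) \<le> 2 * real (Suc s) * real s * real n"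
      by (simp only: of_nat_mult of_nat_numeral)
  qed simp
  finally show ?thesis .
qed

theorem theorem1p2:
  shows "(\<exists>c c' :: real. c > 0 \<and> c' > 0 \<and> (\<forall>n::nat. n \<ge> 2 \<longrightarrow>
            2 powr (c * (log 2 (real n))\<^sup>2) \<le> real (ramsey_number (complete3 4) (star3 n)) \<and>
            real (ramsey_number (complete3 4) (star3 n)) \<le> 2 powr (c' * real n powr (2/3) * log 2 (real n)))) \<and>
         (\<forall>s::nat. s \<ge> 5 \<longrightarrow> (\<exists>c c' :: real. c > 0 \<and> c' > 0 \<and> (\<forall>n::nat. n \<ge> 2 \<longrightarrow>
            2 powr (c * real n) \<le> real (ramsey_number (complete3 s) (star3 n)) \<and>
            real (ramsey_number (complete3 s) (star3 n)) \<le> 2 powr (c' * real n))))"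
proof (intro conjI allI impI)
  show "\<exists>c c' :: real. c > 0 \<and> c' > 0 \<and> (\<forall>n::nat. n \<ge> 2 \<longrightarrow>
      2 powr (c * (log 2 (real n))\<^sup>2) \<le> real (ramsey_number (complete3 4) (star3 n)) \<and>
      real (ramsey_number (complete3 4) (star3 n)) \<le> 2 powr (c' * real n powr (2/3) * log 2 (real n)))"
    using K4_star_lower K4_star_upper by (intro exI[of _ "1 / 576"] exI[of _ 180]) simp
next
  fix s :: nat assume s: "s \<ge> 5"
  then show "\<exists>c c' :: real. c > 0 \<and> c' > 0 \<and> (\<forall>n::nat. n \<ge> 2 \<longrightarrow>
      2 powr (c * real n) \<le> real (ramsey_number (complete3 s) (star3 n)) \<and>
      real (ramsey_number (complete3 s) (star3 n)) \<le> 2 powr (c' * real n))"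
    using clique_star_lower[OF s] clique_star_upper[of _ s]
    by (intro exI[of _ "1 / 64"] exI[of _ "2 * real (Suc s) * real s"]) simp
qed

end
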